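(* Assume the linear model $Y_i=\beta^TX_i+\epsilon_i$, $i=1,\dots,n$, described in the context, and additionally that $\tau^2+\sigma^2$ and $p/n$ are $O(1)$. Also assume that $E(X_{1j}^8)$ is bounded for all $j$ and that the columns of the design matrix $\mathbf{X}$ are independent. Then $$\sqrt n\left[T_{c^*}-T_{\hat c^*}\right]\overset{p}{\rightarrow}0 .$$
   Context: Setting. $(X_1,Y_1),\dots,(X_n,Y_n)$ are i.i.d. with $X_i=(X_{i1},\dots,X_{ip})^T\in\mathbb{R}^p$, $Y_i=\beta^TX_i+\epsilon_i$, $E(\epsilon_i|X_i)=0$, $E(\epsilon_i^2|X_i)=\sigma^2$, $E(X_i)=0$, $\mathrm{Cov}(X_i)=\mathbf{I}$; the distribution of $X$ is known. $\mathbf{X}$ is the $n\times p$ design matrix with rows $X_i^T$. The signal level is $\tau^2=\|\beta\|^2$. Limits are as $n\to\infty$ with $p=p_n$. $W_{ij}=X_{ij}Y_i$, $W_i=(W_{i1},\dots,W_{ip})^T$, and $\hat\tau^2=\binom n2^{-1}\sum_{i_1<i_2}W_{i_1}^TW_{i_2}$ is the naive estimator. Let $g_i=g(X_i)=\sum_{j<j'}X_{ij}X_{ij'}$, $\bar g_n=\frac1n\sum_{i=1}^ng_i$, $S_{ij}=W_{ij}g_i$, $\theta_j=E(S_{ij})$, and let $\mathrm{Var}(g)$ denote $\mathrm{Var}(g_i)$ (which does not depend on $i$). Define $$c^*=\frac{2\sum_{j=1}^p\beta_j\theta_j}{\mathrm{Var}(g)},\qquad \hat c^*=\frac{\frac{2}{n(n-1)}\sum_{i_1\ne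 i_2}\sum_{j=1}^pW_{i_1j}S_{i_2j}}{\mathrm{Var}(g)},$$ $$T_{c^*}=\hat\tau^2-c^*\bar g_n,\qquad T_{\hat c^*}=\hat\tau^2-\hat c^*\bar g_n .$$ *)

theory Defs
  imports "HOL-Probability.Probability" "HOL-Library.Landau_Symbols"
begin

text \<open>
  Observations are numbered \<open>1..n\<close> and covariates \<open>1..p\<close>; \<open>X i j\<close> is the random variable
  \<open>X\<^sub>i\<^sub>j\<close>. Values outside these index ranges are never used.
\<close>

definition row :: "nat \<Rightarrow> (nat \<Rightarrow> nat \<Rightarrow> 'a \<Rightarrow> real) \<Rightarrow> nat \<Rightarrow> 'a \<Rightarrow> nat \<Rightarrow> real" where
  "row p X i \<omega> = (\<lambda>j\<in>{1..p}. X i j \<omega>)"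

definition column :: "nat \<Rightarrow> (nat \<Rightarrow> nat \<Rightarrow> 'a \<Rightarrow> real) \<Rightarrow> nat \<Rightarrow> 'a \<Rightarrow> nat \<Rightarrow> real" where
  "column n X j \<omega> = (\<lambda>i\<in>{1..n}. X i j \<omega>)"

abbreviation vec_borel :: "nat \<Rightarrow> (nat \<Rightarrow> real) measure" where
  "vec_borel m \<equiv> PiM {1..m} (\<lambda>_. borel)"

locale linear_model = prob_space M
  for M :: "'a measure" +
  fixes n p :: nat
    and X :: "nat \<Rightarrow> nat \<Rightarrow> 'a \<Rightarrow> real"
    and Y \<epsilon> :: "nat \<Rightarrow> 'a \<Rightarrow> real"
    and \<beta> :: "nat \<Rightarrow> real"
    and \<sigma> :: real
  assumes independent_observations:
      "indep_vars (\<lambda>_. vec_borel p \<Otimes>\<^sub>M borel) (\<lambda>i \<omega>. (row p X i \<omega>, Y i \<omega>)) {1..n}"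
    and identically_distributed:
      "\<And>i. i \<in> {1..n} \<Longrightarrow>
         distr M (vec_borel p \<Otimes>\<^sub>M borel) (\<lambda>\<omega>. (row p X i \<omega>, Y i \<omega>)) =
         distr M (vec_borel p \<Otimes>\<^sub>M borel) (\<lambda>\<omega>. (row p X 1 \<omega>, Y 1 \<omega>))"
    and response:
      "\<And>i \<omega>. i \<in> {1..n} \<Longrightarrow> \<omega> \<in> space M \<Longrightarrow> Y i \<omega> = (\<Sum>j=1..p. \<beta> j * X i j \<omega>) + \<epsilon> i \<omega>"
    and noise_integrable: "\<And>i. i \<in> {1..n} \<Longrightarrow> integrable M (\<epsilon> i)"
    and noise_mean:
      "\<And>i. i \<in> {1..n} \<Longrightarrow>
         AE \<omega> in M. real_cond_exp M (vimage_algebra (space M) (row p X i) (vec_borel p)) (\<epsilon> i) \<omega> = 0"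
    and noise_square_integrable: "\<And>i. i \<in> {1..n} \<Longrightarrow> integrable M (\<lambda>\<omega>. (\<epsilon> i \<omega>)\<^sup>2)"
    and noise_variance:
      "\<And>i. i \<in> {1..n} \<Longrightarrow>
         AE \<omega> in M. real_cond_exp M (vimage_algebra (space M) (row p X i) (vec_borel p))
           (\<lambda>\<omega>. (\<epsilon> i \<omega>)\<^sup>2) \<omega> = \<sigma>\<^sup>2"
    and covariate_integrable:
      "\<And>i j. i \<in> {1..n} \<Longrightarrow> j \<in> {1..p} \<Longrightarrow> integrable M (X i j)"
    and covariate_mean:
      "\<And>i j. i \<in> {1..n} \<Longrightarrow> j \<in> {1..p} \<Longrightarrow> expectation (X i j) = 0"
    and covariate_product_integrable:
      "\<And>i j k. i \<in> {1..n} \<Longrightarrow> j \<in> {1..p} \<Longrightarrow> k \<in> {1..p} \<Longrightarrow>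
         integrable M (\<lambda>\<omega>. X i j \<omega> * X i k \<omega>)"
    and covariate_cov:
      "\<And>i j k. i \<in> {1..n} \<Longrightarrow> j \<in> {1..p} \<Longrightarrow> k \<in> {1..p} \<Longrightarrow>
         expectation (\<lambda>\<omega>. (X i j \<omega> - expectation (X i j)) * (X i k \<omega> - expectation (X i k)))
           = (if j = k then 1 else 0)"

definition independent_columns ::
    "'a measure \<Rightarrow> nat \<Rightarrow> nat \<Rightarrow> (nat \<Rightarrow> nat \<Rightarrow> 'a \<Rightarrow> real) \<Rightarrow> bool" where
  "independent_columns M n p X \<longleftrightarrow>
     prob_space.indep_vars M (\<lambda>_. vec_borel n) (column n X) {1..p}"

definition signal_level :: "nat \<Rightarrow> (nat \<Rightarrow> real) \<Rightarrow> real" where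
  "signal_level p \<beta> = (\<Sum>j=1..p. (\<beta> j)\<^sup>2)"

definition W :: "(nat \<Rightarrow> nat \<Rightarrow> 'a \<Rightarrow> real) \<Rightarrow> (nat \<Rightarrow> 'a \<Rightarrow> real) \<Rightarrow> nat \<Rightarrow> nat \<Rightarrow> 'a \<Rightarrow> real" where
  "W X Y i j \<omega> = X i j \<omega> * Y i \<omega>"

definition naive_estimator ::
    "nat \<Rightarrow> nat \<Rightarrow> (nat \<Rightarrow> nat \<Rightarrow> 'a \<Rightarrow> real) \<Rightarrow> (nat \<Rightarrow> 'a \<Rightarrow> real) \<Rightarrow> 'a \<Rightarrow> real" where
  "naive_estimator n p X Y \<omega> =
     (\<Sum>i\<^sub>1=1..n. \<Sum>i\<^sub>2=i\<^sub>1+1..n. \<Sum>j=1..p. W X Y i\<^sub>1 j \<omega> * W X Y i\<^sub>2 j \<omega>) / real (n choose 2)"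

definition g :: "nat \<Rightarrow> (nat \<Rightarrow> nat \<Rightarrow> 'a \<Rightarrow> real) \<Rightarrow> nat \<Rightarrow> 'a \<Rightarrow> real" where
  "g p X i \<omega> = (\<Sum>j=1..p. \<Sum>k=j+1..p. X i j \<omega> * X i k \<omega>)"

definition g_mean :: "nat \<Rightarrow> nat \<Rightarrow> (nat \<Rightarrow> nat \<Rightarrow> 'a \<Rightarrow> real) \<Rightarrow> 'a \<Rightarrow> real" where
  "g_mean n p X \<omega> = (\<Sum>i=1..n. g p X i \<omega>) / real n"

definition S ::
    "nat \<Rightarrow> (nat \<Rightarrow> nat \<Rightarrow> 'a \<Rightarrow> real) \<Rightarrow> (nat \<Rightarrow> 'a \<Rightarrow> real) \<Rightarrow> nat \<Rightarrow> nat \<Rightarrow> 'a \<Rightarrow> real" where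
  "S p X Y i j \<omega> = W X Y i j \<omega> * g p X i \<omega>"

text \<open>
  \<open>\<theta>\<^sub>j = E(S\<^sub>i\<^sub>j)\<close> and \<open>Var(g) = Var(g\<^sub>i)\<close> do not depend on \<open>i\<close>, by identical distribution;
  they are taken at \<open>i = 1\<close>.
\<close>

definition \<theta> ::
    "'a measure \<Rightarrow> nat \<Rightarrow> (nat \<Rightarrow> nat \<Rightarrow> 'a \<Rightarrow> real) \<Rightarrow> (nat \<Rightarrow> 'a \<Rightarrow> real) \<Rightarrow> nat \<Rightarrow> real" where
  "\<theta> M p X Y j = prob_space.expectation M (S p X Y 1 j)"

definition var_g :: "'a measure \<Rightarrow> nat \<Rightarrow> (nat \<Rightarrow> nat \<Rightarrow> 'a \<Rightarrow> real) \<Rightarrow> real" where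
  "var_g M p X = prob_space.variance M (g p X 1)"

text \<open>
  For \<open>p \<le> 1\<close> the function \<open>g\<close> vanishes and so does its variance; both coefficients below are
  then \<open>0\<close> since \<open>x / 0 = 0\<close>.
\<close>

definition c_star ::
    "'a measure \<Rightarrow> nat \<Rightarrow> (nat \<Rightarrow> nat \<Rightarrow> 'a \<Rightarrow> real) \<Rightarrow> (nat \<Rightarrow> 'a \<Rightarrow> real) \<Rightarrow> (nat \<Rightarrow> real) \<Rightarrow> real" where
  "c_star M p X Y \<beta> = 2 * (\<Sum>j=1..p. \<beta> j * \<theta> M p X Y j) / var_g M p X"

definition c_hat ::
    "'a measure \<Rightarrow> nat \<Rightarrow> nat \<Rightarrow> (nat \<Rightarrow> nat \<Rightarrow> 'a \<Rightarrow> real) \<Rightarrow> (nat \<Rightarrow> 'a \<Rightarrow> real) \<Rightarrow> 'a \<Rightarrow> real" where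
  "c_hat M n p X Y \<omega> =
     (2 / (real n * (real n - 1)) *
       (\<Sum>i\<^sub>1\<in>{1..n}. \<Sum>i\<^sub>2\<in>{1..n} - {i\<^sub>1}. \<Sum>j=1..p. W X Y i\<^sub>1 j \<omega> * S p X Y i\<^sub>2 j \<omega>))
     / var_g M p X"

definition T ::
    "nat \<Rightarrow> nat \<Rightarrow> (nat \<Rightarrow> nat \<Rightarrow> 'a \<Rightarrow> real) \<Rightarrow> (nat \<Rightarrow> 'a \<Rightarrow> real) \<Rightarrow> real \<Rightarrow> 'a \<Rightarrow> real" where
  "T n p X Y c \<omega> = naive_estimator n p X Y \<omega> - c * g_mean n p X \<omega>"

text \<open>
  Convergence in probability to a constant; the variables may live on different probability
  spaces. Measurability is demanded because \<open>measure\<close> is \<open>0\<close> on non-measurable sets.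
\<close>

definition converges_in_probability ::
    "(nat \<Rightarrow> 'a measure) \<Rightarrow> (nat \<Rightarrow> 'a \<Rightarrow> real) \<Rightarrow> real \<Rightarrow> bool" where
  "converges_in_probability M Z c \<longleftrightarrow>
     (\<forall>\<^sub>F n in sequentially. Z n \<in> borel_measurable (M n)) \<and>
     (\<forall>e>0. (\<lambda>n. measure (M n) {\<omega> \<in> space (M n). \<bar>Z n \<omega> - c\<bar> > e}) \<longlonglongrightarrow> 0)"

end

theory Submission
  imports Defs
begin

text \<open>
  Write \<open>U\<close> for the average of \<open>\<Sum>\<^sub>j W\<^sub>i\<^sub>j S\<^sub>k\<^sub>j\<close> over the ordered pairs \<open>i \<noteq> k\<close>, and \<open>V = Var(g)\<close>.
  Since \<open>E W\<^sub>i\<^sub>j = \<beta>\<^sub>j\<close>, the mean of \<open>U\<close> is \<open>\<mu> = \<Sum>\<^sub>j \<beta>\<^sub>j \<theta>\<^sub>j\<close>, and the two estimators differ only in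
  their coefficients:

  \<open>sqrt n (T(c_star) - T(c_hat)) = 2 / V * (U - \<mu>) * (sqrt n * mean of g)\<close>.

  The last factor has second moment \<open>V\<close>. By the Cauchy--Schwarz inequality the expected absolute
  value of the product is at most \<open>2 sqrt (E(U - \<mu>)\<^sup>2 / V)\<close>. Independent columns give
  \<open>V = p (p - 1) / 2\<close>, which is of order \<open>p\<^sup>2\<close> as soon as \<open>p \<ge> 2\<close>; for \<open>p \<le> 1\<close> both coefficients
  vanish. So it suffices to show \<open>E(U - \<mu>)\<^sup>2 \<le> const * p\<^sup>2 / n\<close>, and Markov's inequality finishes.

  Centering both factors (Hoeffding's decomposition) splits \<open>U - \<mu>\<close> into two averages of \<open>n\<close>
  independent centered variables and a degenerate double sum whose terms are orthogonal except for
  a pair and its reversal. This is \<open>cross_U_statistic_variance\<close>. Its bound involves three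
  quantities: the second moments of \<open>\<Sum>\<^sub>j u\<^sub>j W\<^sub>j\<close> and of \<open>\<Sum>\<^sub>j u\<^sub>j S\<^sub>j\<close>, relative to the squared length
  of \<open>u\<close>, and the squared length of \<open>\<theta>\<close>. Applying the bound to \<open>u = \<theta>\<close> controls the third
  by the second (\<open>theta_square_le\<close>).

  The first two are moments of total degree at most eight in one row of the design matrix. For
  linear forms, \<open>E(\<Sum>\<^sub>j u\<^sub>j X\<^sub>j)\<^sup>8\<close> is at most a constant times the eighth power of the length of
  \<open>u\<close> (\<open>eighth_moment_independent_sum\<close>). The quadratic form \<open>g\<close> reduces to this case because
  \<open>2 g = (\<Sum>\<^sub>j X\<^sub>j)\<^sup>2 - \<Sum>\<^sub>j X\<^sub>j\<^sup>2\<close>, so \<open>E g\<^sup>4\<close> is of order \<open>p\<^sup>4\<close>. All mixed moments then follow from the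
  Cauchy--Schwarz inequality, and the noise enters only through its conditional variance
  (\<open>weighted_response_square\<close>).
\<close>

section \<open>Square-integrable random variables\<close>

context prob_space
begin

definition L2 :: "('a \<Rightarrow> real) \<Rightarrow> bool" where
  "L2 f \<longleftrightarrow> f \<in> borel_measurable M \<and> integrable M (\<lambda>\<omega>. (f \<omega>)\<^sup>2)"

lemma L2_measurable [measurable_dest]: "L2 f \<Longrightarrow> f \<in> borel_measurable M"
  by (simp add: L2_def)

lemma L2_square: "L2 f \<Longrightarrow> integrable M (\<lambda>\<omega>. (f \<omega>)\<^sup>2)"
  by (simp add: L2_def)

lemma L2_mult_integrable:
  assumes "L2 f" "L2 h"
  shows "integrable M (\<lambda>\<omega>. f \<omega> * h \<omega>)"
proof (rule Bochner_Integration.integrable_bound)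
  note [measurable] = assms[THEN L2_measurable]
  show "integrable M (\<lambda>\<omega>. (f \<omega>)\<^sup>2 + (h \<omega>)\<^sup>2)"
    using assms by (simp add: L2_def)
  show "(\<lambda>\<omega>. f \<omega> * h \<omega>) \<in> borel_measurable M"
    by measurable
  have "\<bar>x * y\<bar> \<le> x\<^sup>2 + y\<^sup>2" for x y :: real
  proof -
    have "2 * (\<bar>x\<bar> * \<bar>y\<bar>) \<le> x\<^sup>2 + y\<^sup>2"
      using sum_squares_bound[of "\<bar>x\<bar>" "\<bar>y\<bar>"] by (simp add: mult.assoc)
    moreover have "0 \<le> \<bar>x\<bar> * \<bar>y\<bar>" by simp
    ultimately show ?thesis unfolding abs_mult by linarith
  qed
  then show "AE \<omega> in M. norm (f \<omega> * h \<omega>) \<le> norm ((f \<omega>)\<^sup>2 + (h \<omega>)\<^sup>2)"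
    by auto
qed

lemma L2_const [simp]: "L2 (\<lambda>_. c)"
  by (simp add: L2_def)

lemma L2_integrable: "L2 f \<Longrightarrow> integrable M f"
  using L2_mult_integrable[of f "\<lambda>_. 1"] by simp

lemma L2_cmult: "L2 f \<Longrightarrow> L2 (\<lambda>\<omega>. c * f \<omega>)"
  by (auto simp: L2_def power_mult_distrib)

lemma L2_add:
  assumes "L2 f" "L2 h"
  shows "L2 (\<lambda>\<omega>. f \<omega> + h \<omega>)"
  using assms L2_mult_integrable[OF assms]
  by (auto simp: L2_def power2_sum mult.assoc)

lemma L2_diff:
  assumes "L2 f" "L2 h"
  shows "L2 (\<lambda>\<omega>. f \<omega> - h \<omega>)"
  using L2_add[OF assms(1) L2_cmult[OF assms(2), of "-1"]] by simp

lemma L2_sum: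
  assumes "\<And>i. i \<in> A \<Longrightarrow> L2 (f i)"
  shows "L2 (\<lambda>\<omega>. \<Sum>i\<in>A. f i \<omega>)"
  using assms by (induction A rule: infinite_finite_induct) (auto intro: L2_add)

text \<open>
  The expectation of \<open>(f - t h)\<^sup>2\<close> is a quadratic polynomial in \<open>t\<close> that is never negative, so its
  discriminant is not positive.
\<close>

lemma Cauchy_Schwarz_expectation:
  assumes "L2 f" "L2 h"
  shows "(expectation (\<lambda>\<omega>. f \<omega> * h \<omega>))\<^sup>2
          \<le> expectation (\<lambda>\<omega>. (f \<omega>)\<^sup>2) * expectation (\<lambda>\<omega>. (h \<omega>)\<^sup>2)"
proof -
  define a b c where "a = expectation (\<lambda>\<omega>. (f \<omega>)\<^sup>2)"
    and "b = expectation (\<lambda>\<omega>. f \<omega> * h \<omega>)" and "c = expectation (\<lambda>\<omega>. (h \<omega>)\<^sup>2)"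
  have quadratic: "0 \<le> a - 2 * t * b + t\<^sup>2 * c" for t
  proof -
    have "0 \<le> expectation (\<lambda>\<omega>. (f \<omega> - t * h \<omega>)\<^sup>2)" by simp
    also have "(\<lambda>\<omega>. (f \<omega> - t * h \<omega>)\<^sup>2)
        = (\<lambda>\<omega>. (f \<omega>)\<^sup>2 - 2 * t * (f \<omega> * h \<omega>) + t\<^sup>2 * (h \<omega>)\<^sup>2)"
      by (auto simp: power2_eq_square algebra_simps)
    also have "expectation \<dots> = a - 2 * t * b + t\<^sup>2 * c"
      using assms L2_mult_integrable[OF assms] by (simp add: a_def b_def c_def L2_square)
    finally show ?thesis .
  qed
  have "c \<ge> 0" by (simp add: c_def)
  have "b\<^sup>2 \<le> a * c"
  proof (cases "c = 0")
    case True
    have "b = 0"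
    proof (rule ccontr)
      assume "b \<noteq> 0"
      then show False using quadratic[of "(a + 1) / (2 * b)"] True by (simp add: field_simps)
    qed
    with True show ?thesis by simp
  next
    case False
    with \<open>c \<ge> 0\<close> have "c > 0" by simp
    then show ?thesis using quadratic[of "b / c"]
      by (simp add: field_simps power2_eq_square)
  qed
  then show ?thesis by (simp add: a_def b_def c_def)
qed

text \<open>
  The form in which moments are chained: bounding second moments by squares keeps all later
  constants free of roots.
\<close>

lemma Cauchy_Schwarz_bound:
  assumes "L2 f" "L2 h" "A \<ge> 0" "B \<ge> 0"
    and "expectation (\<lambda>\<omega>. (f \<omega>)\<^sup>2) \<le> A\<^sup>2" "expectation (\<lambda>\<omega>. (h \<omega>)\<^sup>2) \<le> B\<^sup>2"
  shows "expectation (\<lambda>\<omega>. f \<omega> * h \<omega>) \<le> A * B"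
proof (rule power2_le_imp_le)
  have "(expectation (\<lambda>\<omega>. f \<omega> * h \<omega>))\<^sup>2
          \<le> expectation (\<lambda>\<omega>. (f \<omega>)\<^sup>2) * expectation (\<lambda>\<omega>. (h \<omega>)\<^sup>2)"
    by (rule Cauchy_Schwarz_expectation[OF assms(1,2)])
  also have "\<dots> \<le> A\<^sup>2 * B\<^sup>2"
    using assms by (intro mult_mono) auto
  finally show "(expectation (\<lambda>\<omega>. f \<omega> * h \<omega>))\<^sup>2 \<le> (A * B)\<^sup>2"
    by (simp add: power_mult_distrib)
qed (use assms in simp)

text \<open>
  Any statistic of the variables in \<open>J\<close> is independent of a variable outside \<open>J\<close>. The variables
  will be the observations on the one hand and the entries of a single row on the other.
\<close>

lemma indep_var_of_restriction:
  assumes ind: "indep_vars N Z I" and "J \<subseteq> I" "k \<in> I" "k \<notin> J"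
    and G: "G \<in> borel_measurable (PiM J N)" and f: "f \<in> borel_measurable (N k)"
  shows "indep_var borel (\<lambda>\<omega>. G (\<lambda>i\<in>J. Z i \<omega>)) borel (\<lambda>\<omega>. f (Z k \<omega>))"
proof -
  have "indep_var borel (G \<circ> (\<lambda>\<omega>. \<lambda>i\<in>J. Z i \<omega>))
          borel ((\<lambda>z. f (z k)) \<circ> (\<lambda>\<omega>. \<lambda>i\<in>{k}. Z i \<omega>))"
  proof (intro indep_var_compose[OF indep_var_restrict[OF ind]] G)
    show "(\<lambda>z. f (z k)) \<in> borel_measurable (Pi\<^sub>M {k} N)"
      using f by measurable
  qed (use assms in auto)
  then show ?thesis by (simp add: comp_def)
qed

lemma indep_var_power:
  fixes U V :: "'a \<Rightarrow> real"
  assumes "indep_var borel U borel V"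
  shows "indep_var borel (\<lambda>\<omega>. U \<omega> ^ k) borel (\<lambda>\<omega>. V \<omega> ^ l)"
  using indep_var_compose[OF assms, of "\<lambda>x. x ^ k" borel "\<lambda>x. x ^ l" borel] by (simp add: comp_def)

end

section \<open>Eighth moments of sums of independent variables\<close>

text \<open>
  The term linear in \<open>b\<close> is kept exactly, because it has mean zero when \<open>b\<close> is an independent
  centered variable. All the others are at least quadratic in \<open>b\<close>, hence dominated by
  \<open>a\<^sup>6 b\<^sup>2 + b\<^sup>8\<close>, and their binomial coefficients add up to \<open>247 = 2\<^sup>8 - 1 - 8\<close>.
\<close>

lemma eighth_power_expansion_bound:
  fixes a b :: real
  shows "(a + b) ^ 8 \<le> a ^ 8 + 8 * (a ^ 7 * b) + 247 * (a ^ 6 * b\<^sup>2 + b ^ 8)"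
proof -
  have mono: "x ^ (6 - l) * y ^ (2 + l) \<le> x ^ 6 * y ^ 2 + y ^ 8" if "x \<ge> 0" "y \<ge> 0" "l \<le> 6"
    for x y :: real and l :: nat
  proof (cases "x \<le> y")
    case True
    then have "x ^ (6 - l) * y ^ (2 + l) \<le> y ^ (6 - l) * y ^ (2 + l)"
      using that by (intro mult_right_mono power_mono) auto
    also have "\<dots> = y ^ 8" using that by (simp flip: power_add del: power_Suc)
    finally show ?thesis using that by (smt (verit) mult_nonneg_nonneg zero_le_power)
  next
    case False
    then have "x ^ (6 - l) * y ^ (2 + l) = x ^ (6 - l) * (y ^ l * y ^ 2)"
      by (simp flip: power_add add: add.commute)
    also have "\<dots> \<le> x ^ (6 - l) * (x ^ l * y ^ 2)"
      using that False by (intro mult_left_mono mult_right_mono power_mono) auto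
    also have "\<dots> = x ^ 6 * y ^ 2"
      using that by (simp flip: power_add mult.assoc)
    finally show ?thesis using that by (smt (verit) zero_le_power)
  qed
  have m: "a ^ (6 - l) * b ^ (2 + l) \<le> a ^ 6 * b ^ 2 + b ^ 8" if "l \<le> 6" for l
  proof -
    have "a ^ (6 - l) * b ^ (2 + l) \<le> \<bar>a\<bar> ^ (6 - l) * \<bar>b\<bar> ^ (2 + l)"
      using abs_ge_self[of "a ^ (6 - l) * b ^ (2 + l)"] by (simp only: abs_mult power_abs)
    also have "\<dots> \<le> \<bar>a\<bar> ^ 6 * \<bar>b\<bar>\<^sup>2 + \<bar>b\<bar> ^ 8"
      by (rule mono[OF _ _ that]) auto
    also have "\<dots> = a ^ 6 * b ^ 2 + b ^ 8"
      by (simp add: power_even_abs_numeral)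
    finally show ?thesis .
  qed
  have m0: "a ^ 6 * b ^ 2 \<le> a ^ 6 * b ^ 2 + b ^ 8" and m1: "a ^ 5 * b ^ 3 \<le> a ^ 6 * b ^ 2 + b ^ 8"
    and m2: "a ^ 4 * b ^ 4 \<le> a ^ 6 * b ^ 2 + b ^ 8" and m3: "a ^ 3 * b ^ 5 \<le> a ^ 6 * b ^ 2 + b ^ 8"
    and m4: "a ^ 2 * b ^ 6 \<le> a ^ 6 * b ^ 2 + b ^ 8" and m5: "a * b ^ 7 \<le> a ^ 6 * b ^ 2 + b ^ 8"
    and m6: "b ^ 8 \<le> a ^ 6 * b ^ 2 + b ^ 8"
    using m[of 1] m[of 2] m[of 3] m[of 4] m[of 5] m[of 6] by (simp_all add: zero_le_even_power')
  have "(a + b) ^ 8 = a ^ 8 + 8 * (a ^ 7 * b) + (28 * (a ^ 6 * b ^ 2) + 56 * (a ^ 5 * b ^ 3)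
      + 70 * (a ^ 4 * b ^ 4) + 56 * (a ^ 3 * b ^ 5) + 28 * (a ^ 2 * b ^ 6) + 8 * (a * b ^ 7) + b ^ 8)"
    by (simp add: eval_nat_numeral algebra_simps)
  also have "\<dots> \<le> a ^ 8 + 8 * (a ^ 7 * b) + (28 * (a ^ 6 * b ^ 2 + b ^ 8) + 56 * (a ^ 6 * b ^ 2 + b ^ 8)
      + 70 * (a ^ 6 * b ^ 2 + b ^ 8) + 56 * (a ^ 6 * b ^ 2 + b ^ 8) + 28 * (a ^ 6 * b ^ 2 + b ^ 8)
      + 8 * (a ^ 6 * b ^ 2 + b ^ 8) + (a ^ 6 * b ^ 2 + b ^ 8))"
    by (intro add_mono mult_left_mono order_refl m0 m1 m2 m3 m4 m5 m6) auto
  also have "\<dots> = a ^ 8 + 8 * (a ^ 7 * b) + 247 * (a ^ 6 * b\<^sup>2 + b ^ 8)"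
    by (simp add: algebra_simps)
  finally show ?thesis .
qed

context prob_space
begin

lemma integrable_power_le_eight:
  fixes U :: "'a \<Rightarrow> real"
  assumes [measurable]: "U \<in> borel_measurable M" and "integrable M (\<lambda>\<omega>. U \<omega> ^ 8)" "m \<le> 8"
  shows "integrable M (\<lambda>\<omega>. U \<omega> ^ m)"
proof (rule Bochner_Integration.integrable_bound)
  show "integrable M (\<lambda>\<omega>. 1 + U \<omega> ^ 8)" using assms by simp
  have "\<bar>x\<bar> ^ m \<le> 1 + x ^ 8" for x :: real
  proof (cases "\<bar>x\<bar> \<le> 1")
    case True
    then have "\<bar>x\<bar> ^ m \<le> 1" by (simp add: power_le_one)
    then show ?thesis by (smt (verit) zero_le_even_power even_numeral)
  next
    case False
    then have "\<bar>x\<bar> ^ m \<le> \<bar>x\<bar> ^ 8" using assms by (intro power_increasing) auto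
    then show ?thesis by (simp add: power_even_abs)
  qed
  then show "AE \<omega> in M. norm (U \<omega> ^ m) \<le> norm (1 + U \<omega> ^ 8)"
    by (auto simp: power_abs)
qed auto

text \<open>
  Lyapunov's inequality, obtained by repeated use of the Cauchy--Schwarz inequality. The sixth
  moment comes from the factorization \<open>U\<^sup>6 = U\<^sup>2 U\<^sup>4\<close>.
\<close>

lemma moments_le_eighth:
  fixes U :: "'a \<Rightarrow> real"
  assumes [measurable]: "U \<in> borel_measurable M" and U8: "integrable M (\<lambda>\<omega>. U \<omega> ^ 8)"
    and b: "expectation (\<lambda>\<omega>. U \<omega> ^ 8) \<le> b ^ 4" and "b \<ge> 0"
  shows "expectation (\<lambda>\<omega>. (U \<omega>)\<^sup>2) \<le> b"
    and "expectation (\<lambda>\<omega>. U \<omega> ^ 4) \<le> b\<^sup>2"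
    and "expectation (\<lambda>\<omega>. U \<omega> ^ 6) \<le> b ^ 3"
proof -
  have L: "L2 (\<lambda>\<omega>. U \<omega> ^ m)" if "m \<le> 4" for m
    using integrable_power_le_eight[OF assms(1) U8, of "m * 2"] that
    by (simp add: L2_def power_mult)
  show 4: "expectation (\<lambda>\<omega>. U \<omega> ^ 4) \<le> b\<^sup>2"
    using Cauchy_Schwarz_bound[of "\<lambda>\<omega>. U \<omega> ^ 4" "\<lambda>_. 1" "b\<^sup>2" 1] L[of 4] b
    by (simp add: prob_space flip: power_mult)
  show 2: "expectation (\<lambda>\<omega>. (U \<omega>)\<^sup>2) \<le> b"
    using Cauchy_Schwarz_bound[of "\<lambda>\<omega>. U \<omega> ^ 2" "\<lambda>_. 1" "b" 1] L[of 2] 4 \<open>b \<ge> 0\<close>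
    by (simp add: prob_space flip: power_mult)
  have "expectation (\<lambda>\<omega>. U \<omega> ^ 2 * U \<omega> ^ 4) \<le> b * b\<^sup>2"
    using Cauchy_Schwarz_bound[of "\<lambda>\<omega>. U \<omega> ^ 2" "\<lambda>\<omega>. U \<omega> ^ 4" "b" "b\<^sup>2"] L[of 2] L[of 4] 4 b \<open>b \<ge> 0\<close>
    by (simp flip: power_mult)
  moreover have "(\<lambda>\<omega>. U \<omega> ^ 2 * U \<omega> ^ 4) = (\<lambda>\<omega>. U \<omega> ^ 6)" by (simp flip: power_add)
  moreover have "b * b\<^sup>2 = b ^ 3" by (simp add: power2_eq_square power3_eq_cube)
  ultimately show "expectation (\<lambda>\<omega>. U \<omega> ^ 6) \<le> b ^ 3" by simp
qed

lemma integrable_eighth_power_add: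
  fixes U V :: "'a \<Rightarrow> real"
  assumes [measurable]: "U \<in> borel_measurable M" "V \<in> borel_measurable M"
    and "integrable M (\<lambda>\<omega>. U \<omega> ^ 8)" "integrable M (\<lambda>\<omega>. V \<omega> ^ 8)"
  shows "integrable M (\<lambda>\<omega>. (U \<omega> + V \<omega>) ^ 8)"
proof (rule Bochner_Integration.integrable_bound)
  show "integrable M (\<lambda>\<omega>. 256 * (U \<omega> ^ 8 + V \<omega> ^ 8))" using assms by simp
  have "\<bar>x + y\<bar> ^ 8 \<le> 256 * (x ^ 8 + y ^ 8)" for x y :: real
  proof -
    have "\<bar>x + y\<bar> ^ 8 \<le> (2 * max \<bar>x\<bar> \<bar>y\<bar>) ^ 8" by (intro power_mono) auto
    also have "\<dots> = 256 * (max \<bar>x\<bar> \<bar>y\<bar>) ^ 8" by (simp add: power_mult_distrib)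
    also have "\<dots> \<le> 256 * (x ^ 8 + y ^ 8)"
      by (auto simp: max_def power_even_abs)
    finally show ?thesis .
  qed
  then show "AE \<omega> in M. norm ((U \<omega> + V \<omega>) ^ 8) \<le> norm (256 * (U \<omega> ^ 8 + V \<omega> ^ 8))"
    by (auto simp: power_abs)
qed auto

text \<open>
  The induction step for sums: \<open>s\<close> and \<open>v\<close> play the role of variances, and the bound
  \<open>(k * variance)\<^sup>4\<close> is preserved. Expanding, the increment is at most
  \<open>247 ((k s)\<^sup>3 v + C v\<^sup>4)\<close>, whereas \<open>k\<^sup>4 (s + v)\<^sup>4\<close> exceeds \<open>k\<^sup>4 s\<^sup>4\<close> by at least
  \<open>k\<^sup>4 (s\<^sup>3 v + v\<^sup>4)\<close>. Any \<open>k\<close> that is at least \<open>247\<close> and \<open>247 C\<close> therefore works.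
\<close>

lemma eighth_moment_add_independent:
  fixes U V :: "'a \<Rightarrow> real"
  assumes ind: "indep_var borel V borel U"
    and U8: "integrable M (\<lambda>\<omega>. U \<omega> ^ 8)" and V8: "integrable M (\<lambda>\<omega>. V \<omega> ^ 8)"
    and mean: "expectation V = 0"
    and Vsq: "expectation (\<lambda>\<omega>. (V \<omega>)\<^sup>2) \<le> v" and Veight: "expectation (\<lambda>\<omega>. V \<omega> ^ 8) \<le> C * v ^ 4"
    and Ueight: "expectation (\<lambda>\<omega>. U \<omega> ^ 8) \<le> (k * s) ^ 4"
    and "C \<ge> 0" and k: "k = 247 * (1 + C)" and "v \<ge> 0" "s \<ge> 0"
  shows "expectation (\<lambda>\<omega>. (U \<omega> + V \<omega>) ^ 8) \<le> (k * (s + v)) ^ 4"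
proof -
  have [measurable]: "U \<in> borel_measurable M" "V \<in> borel_measurable M"
    using indep_var_rv1[OF ind] indep_var_rv2[OF ind] by auto
  have "k \<ge> 247" using assms by simp
  then have "k \<ge> 0" by simp
  note iU = integrable_power_le_eight[OF _ U8] and iV = integrable_power_le_eight[OF _ V8]
  have U6: "expectation (\<lambda>\<omega>. U \<omega> ^ 6) \<le> (k * s) ^ 3"
    using moments_le_eighth(3)[OF _ U8 Ueight] \<open>k \<ge> 0\<close> \<open>s \<ge> 0\<close> by simp
  have int7: "integrable M (\<lambda>\<omega>. U \<omega> ^ 7 * V \<omega>)"
    and E7: "expectation (\<lambda>\<omega>. U \<omega> ^ 7 * V \<omega>) = 0"
    using indep_var_integrable[OF indep_var_power[OF ind, of 1 7]]
      indep_var_lebesgue_integral[OF indep_var_power[OF ind, of 1 7]] iU[of 7] iV[of 1] mean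
    by (auto simp: mult.commute)
  have int6: "integrable M (\<lambda>\<omega>. U \<omega> ^ 6 * (V \<omega>)\<^sup>2)"
    and E6: "expectation (\<lambda>\<omega>. U \<omega> ^ 6 * (V \<omega>)\<^sup>2)
      = expectation (\<lambda>\<omega>. U \<omega> ^ 6) * expectation (\<lambda>\<omega>. (V \<omega>)\<^sup>2)"
    using indep_var_integrable[OF indep_var_power[OF ind, of 2 6]]
      indep_var_lebesgue_integral[OF indep_var_power[OF ind, of 2 6]] iU[of 6] iV[of 2]
    by (auto simp: mult.commute)
  have "expectation (\<lambda>\<omega>. (U \<omega> + V \<omega>) ^ 8)
      \<le> expectation (\<lambda>\<omega>. U \<omega> ^ 8 + 8 * (U \<omega> ^ 7 * V \<omega>) + 247 * (U \<omega> ^ 6 * (V \<omega>)\<^sup>2 + V \<omega> ^ 8))"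
    using U8 V8 int7 int6
    by (intro integral_mono eighth_power_expansion_bound integrable_eighth_power_add) auto
  also have "\<dots> = expectation (\<lambda>\<omega>. U \<omega> ^ 8)
      + 247 * (expectation (\<lambda>\<omega>. U \<omega> ^ 6) * expectation (\<lambda>\<omega>. (V \<omega>)\<^sup>2) + expectation (\<lambda>\<omega>. V \<omega> ^ 8))"
    using U8 V8 int7 int6 by (simp add: E6 E7)
  also have "\<dots> \<le> (k * s) ^ 4 + 247 * ((k * s) ^ 3 * v + C * v ^ 4)"
    using U6 Ueight Vsq Veight \<open>k \<ge> 0\<close> \<open>s \<ge> 0\<close>
    by (intro add_mono mult_left_mono mult_mono) auto
  also have "\<dots> = k ^ 4 * s ^ 4 + 247 * k ^ 3 * (s ^ 3 * v) + (247 * C) * v ^ 4"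
    by (simp add: power_mult_distrib algebra_simps)
  also have "\<dots> \<le> k ^ 4 * s ^ 4 + k ^ 4 * (s ^ 3 * v) + k ^ 4 * v ^ 4"
  proof (intro add_mono mult_right_mono order_refl)
    show "247 * k ^ 3 \<le> k ^ 4"
      using mult_right_mono[OF \<open>k \<ge> 247\<close>, of "k ^ 3"] \<open>k \<ge> 0\<close>
      by (simp add: eval_nat_numeral)
    have "247 * C \<le> k" by (simp add: k)
    also have "\<dots> \<le> k ^ 4" using \<open>k \<ge> 247\<close> by (intro self_le_power) auto
    finally show "247 * C \<le> k ^ 4" .
  qed (use \<open>s \<ge> 0\<close> \<open>v \<ge> 0\<close> in auto)
  also have "\<dots> = k ^ 4 * (s ^ 4 + s ^ 3 * v + v ^ 4)" by (simp add: algebra_simps)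
  also have "\<dots> \<le> k ^ 4 * (s + v) ^ 4"
  proof (rule mult_left_mono)
    have "(s + v) ^ 4 = (s ^ 4 + s ^ 3 * v + v ^ 4) + (3 * s ^ 3 * v + 6 * s ^ 2 * v ^ 2 + 4 * s * v ^ 3)"
      by (simp add: eval_nat_numeral algebra_simps)
    then show "s ^ 4 + s ^ 3 * v + v ^ 4 \<le> (s + v) ^ 4"
      using \<open>s \<ge> 0\<close> \<open>v \<ge> 0\<close> by simp
  qed simp
  finally show ?thesis by (simp add: power_mult_distrib)
qed

text \<open>
  Eighth moments of independent centered sums grow like the fourth power of the variance, with a
  constant that does not depend on the number of summands.
\<close>

lemma eighth_moment_independent_sum:
  fixes V :: "'i \<Rightarrow> 'a \<Rightarrow> real"
  assumes "finite J" and ind: "indep_vars (\<lambda>_. borel) V J"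
    and V8: "\<And>j. j \<in> J \<Longrightarrow> integrable M (\<lambda>\<omega>. V j \<omega> ^ 8)"
    and mean: "\<And>j. j \<in> J \<Longrightarrow> expectation (V j) = 0"
    and Vsq: "\<And>j. j \<in> J \<Longrightarrow> expectation (\<lambda>\<omega>. (V j \<omega>)\<^sup>2) \<le> v j"
    and Veight: "\<And>j. j \<in> J \<Longrightarrow> expectation (\<lambda>\<omega>. V j \<omega> ^ 8) \<le> C * v j ^ 4"
    and "C \<ge> 0" and v: "\<And>j. j \<in> J \<Longrightarrow> 0 \<le> v j"
  shows "integrable M (\<lambda>\<omega>. (\<Sum>j\<in>J. V j \<omega>) ^ 8)"
    and "expectation (\<lambda>\<omega>. (\<Sum>j\<in>J. V j \<omega>) ^ 8) \<le> (247 * (1 + C) * (\<Sum>j\<in>J. v j)) ^ 4"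
proof -
  have "integrable M (\<lambda>\<omega>. (\<Sum>j\<in>J. V j \<omega>) ^ 8) \<and>
    expectation (\<lambda>\<omega>. (\<Sum>j\<in>J. V j \<omega>) ^ 8) \<le> (247 * (1 + C) * (\<Sum>j\<in>J. v j)) ^ 4"
    using assms(1) ind V8 mean Vsq Veight v
  proof (induction J rule: finite_induct)
    case empty
    then show ?case by simp
  next
    case (insert j J)
    have IH: "integrable M (\<lambda>\<omega>. (\<Sum>j\<in>J. V j \<omega>) ^ 8)"
      "expectation (\<lambda>\<omega>. (\<Sum>j\<in>J. V j \<omega>) ^ 8) \<le> (247 * (1 + C) * (\<Sum>j\<in>J. v j)) ^ 4"
      using insert.IH[OF indep_vars_subset[OF insert.prems(1)]] insert.prems by auto
    have ind': "indep_var borel (V j) borel (\<lambda>\<omega>. \<Sum>j\<in>J. V j \<omega>)"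
      using insert.hyps insert.prems(1) by (intro indep_vars_sum) auto
    have "expectation (\<lambda>\<omega>. ((\<Sum>j\<in>J. V j \<omega>) + V j \<omega>) ^ 8)
        \<le> (247 * (1 + C) * ((\<Sum>j\<in>J. v j) + v j)) ^ 4"
      using insert.prems \<open>C \<ge> 0\<close> IH
      by (intro eighth_moment_add_independent[OF ind']) (auto intro: sum_nonneg)
    moreover have "integrable M (\<lambda>\<omega>. ((\<Sum>j\<in>J. V j \<omega>) + V j \<omega>) ^ 8)"
      using IH insert.prems indep_var_rv1[OF ind'] indep_var_rv2[OF ind']
      by (intro integrable_eighth_power_add) auto
    ultimately show ?case using insert.hyps by (simp add: add.commute)
  qed
  then show "integrable M (\<lambda>\<omega>. (\<Sum>j\<in>J. V j \<omega>) ^ 8)"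
    and "expectation (\<lambda>\<omega>. (\<Sum>j\<in>J. V j \<omega>) ^ 8) \<le> (247 * (1 + C) * (\<Sum>j\<in>J. v j)) ^ 4"
    by auto
qed

end

section \<open>Cross U-statistics of an independent, identically distributed sample\<close>

context prob_space
begin

lemma expectation_square_sum:
  assumes "\<And>x. x \<in> P \<Longrightarrow> L2 (h x)"
  shows "expectation (\<lambda>\<omega>. (\<Sum>x\<in>P. h x \<omega>)\<^sup>2) = (\<Sum>x\<in>P. \<Sum>y\<in>P. expectation (\<lambda>\<omega>. h x \<omega> * h y \<omega>))"
proof -
  have "expectation (\<lambda>\<omega>. (\<Sum>x\<in>P. h x \<omega>)\<^sup>2) = expectation (\<lambda>\<omega>. \<Sum>x\<in>P. \<Sum>y\<in>P. h x \<omega> * h y \<omega>)"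
    by (simp add: power2_eq_square sum_product)
  also have "\<dots> = (\<Sum>x\<in>P. \<Sum>y\<in>P. expectation (\<lambda>\<omega>. h x \<omega> * h y \<omega>))"
    using assms by (simp add: L2_mult_integrable)
  finally show ?thesis .
qed

lemma expectation_square_centered_le:
  assumes "L2 f" "expectation f = m"
  shows "expectation (\<lambda>\<omega>. (f \<omega> - m)\<^sup>2) \<le> expectation (\<lambda>\<omega>. (f \<omega>)\<^sup>2)"
proof -
  have "expectation (\<lambda>\<omega>. (f \<omega> - m)\<^sup>2) = expectation (\<lambda>\<omega>. (f \<omega>)\<^sup>2 - 2 * m * f \<omega> + m\<^sup>2)"
    by (simp add: power2_diff algebra_simps)
  also have "\<dots> = expectation (\<lambda>\<omega>. (f \<omega>)\<^sup>2) - m\<^sup>2"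
    using assms L2_integrable[OF assms(1)] L2_square[OF assms(1)]
    by (simp add: prob_space) (simp add: power2_eq_square)
  finally show ?thesis by simp
qed

end

locale iid_sample = prob_space M
  for M :: "'a measure" +
  fixes n :: nat and N :: "'b measure" and Z :: "nat \<Rightarrow> 'a \<Rightarrow> 'b"
  assumes indep: "indep_vars (\<lambda>_. N) Z {1..n}"
    and identical: "\<And>i. i \<in> {1..n} \<Longrightarrow> distr M N (Z i) = distr M N (Z 1)"
begin

lemma Z_measurable: "i \<in> {1..n} \<Longrightarrow> Z i \<in> measurable M N"
  using indep by (simp add: indep_vars_def)

lemma measurable_Z: "i \<in> {1..n} \<Longrightarrow> f \<in> borel_measurable N \<Longrightarrow> (\<lambda>\<omega>. f (Z i \<omega>)) \<in> borel_measurable M"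
  using measurable_compose[OF Z_measurable] by auto

lemma same_distribution:
  fixes f :: "'b \<Rightarrow> real"
  assumes i: "i \<in> {1..n}" and f: "f \<in> borel_measurable N"
  shows expectation_Z: "expectation (\<lambda>\<omega>. f (Z i \<omega>)) = expectation (\<lambda>\<omega>. f (Z 1 \<omega>))"
    and integrable_Z: "integrable M (\<lambda>\<omega>. f (Z 1 \<omega>)) \<Longrightarrow> integrable M (\<lambda>\<omega>. f (Z i \<omega>))"
    and L2_Z: "L2 (\<lambda>\<omega>. f (Z 1 \<omega>)) \<Longrightarrow> L2 (\<lambda>\<omega>. f (Z i \<omega>))"
proof -
  have 1: "1 \<in> {1..n}" using i by auto
  show "expectation (\<lambda>\<omega>. f (Z i \<omega>)) = expectation (\<lambda>\<omega>. f (Z 1 \<omega>))"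
    using integral_distr[OF Z_measurable[OF i] f] integral_distr[OF Z_measurable[OF 1] f]
      identical[OF i] by simp
  have int: "integrable M (\<lambda>\<omega>. h (Z i \<omega>)) \<longleftrightarrow> integrable M (\<lambda>\<omega>. h (Z 1 \<omega>))"
    if "h \<in> borel_measurable N" for h :: "'b \<Rightarrow> real"
    using integrable_distr_eq[OF Z_measurable[OF i] that]
      integrable_distr_eq[OF Z_measurable[OF 1] that] identical[OF i] by simp
  show "integrable M (\<lambda>\<omega>. f (Z 1 \<omega>)) \<Longrightarrow> integrable M (\<lambda>\<omega>. f (Z i \<omega>))"
    using int[OF f] by simp
  show "L2 (\<lambda>\<omega>. f (Z 1 \<omega>)) \<Longrightarrow> L2 (\<lambda>\<omega>. f (Z i \<omega>))"
    using int[of "\<lambda>z. (f z)\<^sup>2"] f measurable_Z[OF i f] by (simp add: L2_def)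
qed

lemma expectation_restriction_mult:
  fixes G :: "(nat \<Rightarrow> 'b) \<Rightarrow> real" and f :: "'b \<Rightarrow> real"
  assumes "J \<subseteq> {1..n}" "k \<in> {1..n}" "k \<notin> J"
    and G: "G \<in> borel_measurable (PiM J (\<lambda>_. N))" and f: "f \<in> borel_measurable N"
    and "integrable M (\<lambda>\<omega>. G (\<lambda>i\<in>J. Z i \<omega>))" and int: "integrable M (\<lambda>\<omega>. f (Z 1 \<omega>))"
  shows "expectation (\<lambda>\<omega>. G (\<lambda>i\<in>J. Z i \<omega>) * f (Z k \<omega>))
      = expectation (\<lambda>\<omega>. G (\<lambda>i\<in>J. Z i \<omega>)) * expectation (\<lambda>\<omega>. f (Z 1 \<omega>))"
    and "integrable M (\<lambda>\<omega>. G (\<lambda>i\<in>J. Z i \<omega>) * f (Z k \<omega>))"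
proof -
  note ind = indep_var_of_restriction[OF indep \<open>J \<subseteq> {1..n}\<close> \<open>k \<in> {1..n}\<close> \<open>k \<notin> J\<close> G f]
  note int' = integrable_Z[OF \<open>k \<in> {1..n}\<close> f int]
  show "expectation (\<lambda>\<omega>. G (\<lambda>i\<in>J. Z i \<omega>) * f (Z k \<omega>))
      = expectation (\<lambda>\<omega>. G (\<lambda>i\<in>J. Z i \<omega>)) * expectation (\<lambda>\<omega>. f (Z 1 \<omega>))"
    using indep_var_lebesgue_integral[OF ind assms(6) int'] expectation_Z[OF assms(2) f] by simp
  show "integrable M (\<lambda>\<omega>. G (\<lambda>i\<in>J. Z i \<omega>) * f (Z k \<omega>))"
    by (rule indep_var_integrable[OF ind assms(6) int'])
qed

lemma expectation_mult_distinct: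
  fixes f h :: "'b \<Rightarrow> real"
  assumes ik: "i \<in> {1..n}" "k \<in> {1..n}" "i \<noteq> k"
    and h: "h \<in> borel_measurable N" and f: "f \<in> borel_measurable N"
    and "integrable M (\<lambda>\<omega>. h (Z 1 \<omega>))" "integrable M (\<lambda>\<omega>. f (Z 1 \<omega>))"
  shows "expectation (\<lambda>\<omega>. h (Z i \<omega>) * f (Z k \<omega>))
      = expectation (\<lambda>\<omega>. h (Z 1 \<omega>)) * expectation (\<lambda>\<omega>. f (Z 1 \<omega>))"
    and "integrable M (\<lambda>\<omega>. h (Z i \<omega>) * f (Z k \<omega>))"
proof -
  have G: "(\<lambda>z. h (z i)) \<in> borel_measurable (PiM {i} (\<lambda>_. N))"
    using h by measurable
  note * = expectation_restriction_mult[OF _ ik(2) _ G f _ assms(7)]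
  show "expectation (\<lambda>\<omega>. h (Z i \<omega>) * f (Z k \<omega>))
      = expectation (\<lambda>\<omega>. h (Z 1 \<omega>)) * expectation (\<lambda>\<omega>. f (Z 1 \<omega>))"
    and "integrable M (\<lambda>\<omega>. h (Z i \<omega>) * f (Z k \<omega>))"
    using * ik assms expectation_Z[OF ik(1) h] integrable_Z[OF ik(1) h] by auto
qed

lemma L2_mult_distinct:
  fixes f h :: "'b \<Rightarrow> real"
  assumes "i \<in> {1..n}" "k \<in> {1..n}" "i \<noteq> k"
    and [measurable]: "h \<in> borel_measurable N" "f \<in> borel_measurable N"
    and "L2 (\<lambda>\<omega>. h (Z 1 \<omega>))" "L2 (\<lambda>\<omega>. f (Z 1 \<omega>))"
  shows "L2 (\<lambda>\<omega>. h (Z i \<omega>) * f (Z k \<omega>))"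
  using expectation_mult_distinct(2)[of i k "\<lambda>z. (h z)\<^sup>2" "\<lambda>z. (f z)\<^sup>2"] assms
    measurable_Z[of i h] measurable_Z[of k f]
  by (auto simp: L2_def power_mult_distrib)

text \<open>
  A centered factor whose index \<open>x\<close> occurs nowhere else annihilates the expectation. The other
  three indices may overlap, except that \<open>i \<noteq> k\<close>, which is what makes the product
  \<open>v (Z i) w (Z k)\<close> square integrable.
\<close>

lemma expectation_mult_centered_eq_0:
  fixes u v w f :: "'b \<Rightarrow> real"
  assumes idx: "x \<in> {1..n}" "y \<in> {1..n}" "i \<in> {1..n}" "k \<in> {1..n}"
    and x: "x \<noteq> y" "x \<noteq> i" "x \<noteq> k" and "i \<noteq> k"
    and [measurable]: "u \<in> borel_measurable N" "v \<in> borel_measurable N" "w \<in> borel_measurable N"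
      "f \<in> borel_measurable N"
    and L: "L2 (\<lambda>\<omega>. u (Z 1 \<omega>))" "L2 (\<lambda>\<omega>. v (Z 1 \<omega>))" "L2 (\<lambda>\<omega>. w (Z 1 \<omega>))" "L2 (\<lambda>\<omega>. f (Z 1 \<omega>))"
    and f0: "expectation (\<lambda>\<omega>. f (Z 1 \<omega>)) = 0"
  shows "expectation (\<lambda>\<omega>. u (Z y \<omega>) * (v (Z i \<omega>) * w (Z k \<omega>)) * f (Z x \<omega>)) = 0"
    and "integrable M (\<lambda>\<omega>. u (Z y \<omega>) * (v (Z i \<omega>) * w (Z k \<omega>)) * f (Z x \<omega>))"
proof -
  have "L2 (\<lambda>\<omega>. v (Z i \<omega>) * w (Z k \<omega>))"
    using assms by (intro L2_mult_distinct) auto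
  moreover have "L2 (\<lambda>\<omega>. u (Z y \<omega>))" by (rule L2_Z) (use assms in auto)
  ultimately have "integrable M (\<lambda>\<omega>. u (Z y \<omega>) * (v (Z i \<omega>) * w (Z k \<omega>)))"
    by (rule L2_mult_integrable[rotated])
  moreover have G: "(\<lambda>z. u (z y) * (v (z i) * w (z k))) \<in> borel_measurable (PiM {y, i, k} (\<lambda>_. N))"
    by measurable
  ultimately show "expectation (\<lambda>\<omega>. u (Z y \<omega>) * (v (Z i \<omega>) * w (Z k \<omega>)) * f (Z x \<omega>)) = 0"
    and "integrable M (\<lambda>\<omega>. u (Z y \<omega>) * (v (Z i \<omega>) * w (Z k \<omega>)) * f (Z x \<omega>))"
    using expectation_restriction_mult[OF _ idx(1) _ G \<open>f \<in> borel_measurable N\<close>] assms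
    by (auto simp: L2_integrable)
qed

lemma expectation_square_centered_sum:
  fixes f :: "'b \<Rightarrow> real"
  assumes f: "f \<in> borel_measurable N" and L: "L2 (\<lambda>\<omega>. f (Z 1 \<omega>))" and mean: "expectation (\<lambda>\<omega>. f (Z 1 \<omega>)) = 0"
  shows "expectation (\<lambda>\<omega>. (\<Sum>i=1..n. f (Z i \<omega>))\<^sup>2) = real n * expectation (\<lambda>\<omega>. (f (Z 1 \<omega>))\<^sup>2)"
proof -
  have "expectation (\<lambda>\<omega>. (\<Sum>i=1..n. f (Z i \<omega>))\<^sup>2)
      = (\<Sum>i=1..n. \<Sum>k=1..n. expectation (\<lambda>\<omega>. f (Z i \<omega>) * f (Z k \<omega>)))"
    by (rule expectation_square_sum[OF L2_Z[OF _ f L]])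
  also have "\<dots> = (\<Sum>i=1..n. \<Sum>k=1..n. if i = k then expectation (\<lambda>\<omega>. (f (Z 1 \<omega>))\<^sup>2) else 0)"
  proof (intro sum.cong refl)
    fix i k assume ik: "i \<in> {1..n}" "k \<in> {1..n}"
    show "expectation (\<lambda>\<omega>. f (Z i \<omega>) * f (Z k \<omega>)) = (if i = k then expectation (\<lambda>\<omega>. (f (Z 1 \<omega>))\<^sup>2) else 0)"
    proof (cases "i = k")
      case True
      have "(\<lambda>z. (f z)\<^sup>2) \<in> borel_measurable N" using f by measurable
      from expectation_Z[OF ik(2) this] show ?thesis using True by (simp add: power2_eq_square)
    next
      case False
      then show ?thesis
        using expectation_mult_distinct(1)[OF ik False f f] mean L by (simp add: L2_integrable)
    qed
  qed
  also have "\<dots> = real n * expectation (\<lambda>\<omega>. (f (Z 1 \<omega>))\<^sup>2)" by simp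
  finally show ?thesis .
qed

text \<open>
  For independent \<open>a\<close> and \<open>b\<close>, the second moment of their inner product is the expectation over
  \<open>b\<close> of the quadratic form of the covariance matrix of \<open>a\<close>, evaluated at \<open>b\<close>. The bound \<open>K\<close> on that
  form applies for each fixed \<open>b\<close>. The sums being finite, linearity replaces Fubini's theorem.
\<close>

lemma expectation_square_decoupled_inner:
  fixes a b :: "'j \<Rightarrow> 'b \<Rightarrow> real"
  assumes ik: "i \<in> {1..n}" "k \<in> {1..n}" "i \<noteq> k"
    and a [measurable]: "\<And>j. j \<in> J \<Longrightarrow> a j \<in> borel_measurable N"
    and b [measurable]: "\<And>j. j \<in> J \<Longrightarrow> b j \<in> borel_measurable N"
    and aL: "\<And>j. j \<in> J \<Longrightarrow> L2 (\<lambda>\<omega>. a j (Z 1 \<omega>))" and bL: "\<And>j. j \<in> J \<Longrightarrow> L2 (\<lambda>\<omega>. b j (Z 1 \<omega>))"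
    and K: "\<And>u. expectation (\<lambda>\<omega>. (\<Sum>j\<in>J. u j * a j (Z 1 \<omega>))\<^sup>2) \<le> K * (\<Sum>j\<in>J. (u j)\<^sup>2)"
  shows "expectation (\<lambda>\<omega>. (\<Sum>j\<in>J. a j (Z i \<omega>) * b j (Z k \<omega>))\<^sup>2)
     \<le> K * (\<Sum>j\<in>J. expectation (\<lambda>\<omega>. (b j (Z 1 \<omega>))\<^sup>2))"
proof -
  define A where "A j l = expectation (\<lambda>\<omega>. a j (Z 1 \<omega>) * a l (Z 1 \<omega>))" for j l
  have quadratic: "(\<Sum>j\<in>J. \<Sum>l\<in>J. A j l * (u j * u l)) \<le> K * (\<Sum>j\<in>J. (u j)\<^sup>2)" for u
  proof -
    have "(\<Sum>j\<in>J. \<Sum>l\<in>J. A j l * (u j * u l))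
      = (\<Sum>j\<in>J. \<Sum>l\<in>J. expectation (\<lambda>\<omega>. (u j * a j (Z 1 \<omega>)) * (u l * a l (Z 1 \<omega>))))"
      unfolding A_def
    proof (intro sum.cong refl)
      fix j l
      have "(\<lambda>\<omega>. (u j * a j (Z 1 \<omega>)) * (u l * a l (Z 1 \<omega>)))
        = (\<lambda>\<omega>. (u j * u l) * (a j (Z 1 \<omega>) * a l (Z 1 \<omega>)))" by (simp add: ac_simps)
      then show "expectation (\<lambda>\<omega>. a j (Z 1 \<omega>) * a l (Z 1 \<omega>)) * (u j * u l)
        = expectation (\<lambda>\<omega>. (u j * a j (Z 1 \<omega>)) * (u l * a l (Z 1 \<omega>)))"
        by simp
    qed
    also have "\<dots> = expectation (\<lambda>\<omega>. (\<Sum>j\<in>J. u j * a j (Z 1 \<omega>))\<^sup>2)"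
      by (intro expectation_square_sum[symmetric] L2_cmult aL)
    finally show ?thesis using K by simp
  qed
  have "expectation (\<lambda>\<omega>. (\<Sum>j\<in>J. a j (Z i \<omega>) * b j (Z k \<omega>))\<^sup>2)
     = (\<Sum>j\<in>J. \<Sum>l\<in>J. expectation (\<lambda>\<omega>. (a j (Z i \<omega>) * b j (Z k \<omega>)) * (a l (Z i \<omega>) * b l (Z k \<omega>))))"
    using assms by (intro expectation_square_sum L2_mult_distinct) auto
  also have "\<dots> = (\<Sum>j\<in>J. \<Sum>l\<in>J. A j l * expectation (\<lambda>\<omega>. b j (Z 1 \<omega>) * b l (Z 1 \<omega>)))"
  proof (intro sum.cong refl)
    fix j l assume jl [simp]: "j \<in> J" "l \<in> J"
    have "expectation (\<lambda>\<omega>. (a j (Z i \<omega>) * a l (Z i \<omega>)) * (b j (Z k \<omega>) * b l (Z k \<omega>)))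
      = A j l * expectation (\<lambda>\<omega>. b j (Z 1 \<omega>) * b l (Z 1 \<omega>))"
      unfolding A_def
      by (intro expectation_mult_distinct(1)[OF ik, of "\<lambda>z. a j z * a l z" "\<lambda>z. b j z * b l z"]
          L2_mult_integrable aL bL jl borel_measurable_times a b)
    then show "expectation (\<lambda>\<omega>. (a j (Z i \<omega>) * b j (Z k \<omega>)) * (a l (Z i \<omega>) * b l (Z k \<omega>)))
      = A j l * expectation (\<lambda>\<omega>. b j (Z 1 \<omega>) * b l (Z 1 \<omega>))"
      by (simp add: ac_simps)
  qed
  also have "\<dots> = expectation (\<lambda>\<omega>. \<Sum>j\<in>J. \<Sum>l\<in>J. A j l * (b j (Z 1 \<omega>) * b l (Z 1 \<omega>)))"
    using bL by (simp add: L2_mult_integrable)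
  also have "\<dots> \<le> expectation (\<lambda>\<omega>. K * (\<Sum>j\<in>J. (b j (Z 1 \<omega>))\<^sup>2))"
    by (intro integral_mono quadratic) (use bL in \<open>auto simp: L2_mult_integrable L2_square\<close>)
  also have "\<dots> = K * (\<Sum>j\<in>J. expectation (\<lambda>\<omega>. (b j (Z 1 \<omega>))\<^sup>2))"
    using bL by (simp add: L2_square)
  finally show ?thesis .
qed

text \<open>
  Two terms of the double sum with index pairs \<open>(i, k)\<close> and \<open>(i', k')\<close> are orthogonal unless these
  are equal or reversed: otherwise one of \<open>i\<close>, \<open>k\<close> occurs in only one of the terms. Each row of
  the Gram matrix thus has at most two nonzero entries, none larger than \<open>R\<close>.
\<close>

lemma expectation_square_degenerate_double_sum:
  fixes a b :: "'j \<Rightarrow> 'b \<Rightarrow> real"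
  assumes a [measurable]: "\<And>j. j \<in> J \<Longrightarrow> a j \<in> borel_measurable N"
    and b [measurable]: "\<And>j. j \<in> J \<Longrightarrow> b j \<in> borel_measurable N"
    and aL: "\<And>j. j \<in> J \<Longrightarrow> L2 (\<lambda>\<omega>. a j (Z 1 \<omega>))" and bL: "\<And>j. j \<in> J \<Longrightarrow> L2 (\<lambda>\<omega>. b j (Z 1 \<omega>))"
    and a0: "\<And>j. j \<in> J \<Longrightarrow> expectation (\<lambda>\<omega>. a j (Z 1 \<omega>)) = 0"
    and b0: "\<And>j. j \<in> J \<Longrightarrow> expectation (\<lambda>\<omega>. b j (Z 1 \<omega>)) = 0"
    and K: "\<And>u. expectation (\<lambda>\<omega>. (\<Sum>j\<in>J. u j * a j (Z 1 \<omega>))\<^sup>2) \<le> K * (\<Sum>j\<in>J. (u j)\<^sup>2)"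
    and R: "K * (\<Sum>j\<in>J. expectation (\<lambda>\<omega>. (b j (Z 1 \<omega>))\<^sup>2)) \<le> R" and "R \<ge> 0" and "n \<ge> 1"
  shows "expectation (\<lambda>\<omega>. (\<Sum>i\<in>{1..n}. \<Sum>k\<in>{1..n} - {i}. \<Sum>j\<in>J. a j (Z i \<omega>) * b j (Z k \<omega>))\<^sup>2)
     \<le> 2 * R * (real n * (real n - 1))"
    and "L2 (\<lambda>\<omega>. \<Sum>i\<in>{1..n}. \<Sum>k\<in>{1..n} - {i}. \<Sum>j\<in>J. a j (Z i \<omega>) * b j (Z k \<omega>))"
proof -
  define P where "P = Sigma {1..n} (\<lambda>i. {1..n} - {i})"
  define h where "h x \<omega> = (\<Sum>j\<in>J. a j (Z (fst x) \<omega>) * b j (Z (snd x) \<omega>))" for x \<omega>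
  have P: "finite P" "\<And>i k. (i, k) \<in> P \<longleftrightarrow> i \<in> {1..n} \<and> k \<in> {1..n} \<and> i \<noteq> k"
    by (auto simp: P_def)
  have hL: "L2 (h x)" if "x \<in> P" for x
    unfolding h_def using that P(2) assms
    by (cases x) (auto intro!: L2_sum L2_mult_distinct)
  have hR: "expectation (\<lambda>\<omega>. (h x \<omega>)\<^sup>2) \<le> R" if "x \<in> P" for x
    unfolding h_def using that P(2)
    by (cases x) (auto intro!: order_trans[OF expectation_square_decoupled_inner R] assms)
  have orth: "expectation (\<lambda>\<omega>. h (i, k) \<omega> * h (i', k') \<omega>) = 0"
    if ik: "(i, k) \<in> P" "(i', k') \<in> P" "(i', k') \<noteq> (i, k)" "(i', k') \<noteq> (k, i)" for i k i' k'
  proof -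
    have idx: "i \<in> {1..n}" "k \<in> {1..n}" "i' \<in> {1..n}" "k' \<in> {1..n}" "i \<noteq> k" "i' \<noteq> k'"
      using ik P(2) by auto
    have "expectation (\<lambda>\<omega>. h (i, k) \<omega> * h (i', k') \<omega>) = expectation (\<lambda>\<omega>. \<Sum>j\<in>J. \<Sum>l\<in>J.
        (a j (Z i \<omega>) * b j (Z k \<omega>)) * (a l (Z i' \<omega>) * b l (Z k' \<omega>)))"
      by (simp add: h_def sum_product)
    also have "\<dots> = (\<Sum>j\<in>J. \<Sum>l\<in>J. expectation (\<lambda>\<omega>.
        (a j (Z i \<omega>) * b j (Z k \<omega>)) * (a l (Z i' \<omega>) * b l (Z k' \<omega>))))"
      using assms idx by (simp add: L2_mult_integrable L2_mult_distinct)
    also have "\<dots> = 0"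
    proof (intro sum.neutral ballI)
      fix j l assume jl: "j \<in> J" "l \<in> J"
      \<comment> \<open>If both \<open>i\<close> and \<open>k\<close> occurred in \<open>{i', k'}\<close>, the pairs would be equal or reversed.\<close>
      consider "k \<noteq> i'" "k \<noteq> k'" | "i \<noteq> i'" "i \<noteq> k'" using ik idx by auto
      then show "expectation (\<lambda>\<omega>. (a j (Z i \<omega>) * b j (Z k \<omega>)) * (a l (Z i' \<omega>) * b l (Z k' \<omega>))) = 0"
      proof cases
        case 1
        have "expectation (\<lambda>\<omega>. a j (Z i \<omega>) * (a l (Z i' \<omega>) * b l (Z k' \<omega>)) * b j (Z k \<omega>)) = 0"
          by (rule expectation_mult_centered_eq_0(1)[OF idx(2,1,3,4) idx(5)[symmetric] 1 idx(6)
                a[OF jl(1)] a[OF jl(2)] b[OF jl(2)] b[OF jl(1)]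
                aL[OF jl(1)] aL[OF jl(2)] bL[OF jl(2)] bL[OF jl(1)] b0[OF jl(1)]])
        then show ?thesis by (simp add: ac_simps)
      next
        case 2
        have "expectation (\<lambda>\<omega>. b j (Z k \<omega>) * (a l (Z i' \<omega>) * b l (Z k' \<omega>)) * a j (Z i \<omega>)) = 0"
          by (rule expectation_mult_centered_eq_0(1)[OF idx(1,2,3,4) idx(5) 2 idx(6)
                b[OF jl(1)] a[OF jl(2)] b[OF jl(2)] a[OF jl(1)]
                bL[OF jl(1)] aL[OF jl(2)] bL[OF jl(2)] aL[OF jl(1)] a0[OF jl(1)]])
        then show ?thesis by (simp add: ac_simps)
      qed
    qed
    finally show ?thesis .
  qed
  have row_sum: "(\<Sum>y\<in>P. expectation (\<lambda>\<omega>. h x \<omega> * h y \<omega>)) \<le> 2 * R" if "x \<in> P" for x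
  proof -
    obtain i k where x: "x = (i, k)" by (cases x)
    have "(k, i) \<in> P" "i \<noteq> k" using that P(2) x by auto
    have "(\<Sum>y\<in>P. expectation (\<lambda>\<omega>. h x \<omega> * h y \<omega>)) = (\<Sum>y\<in>{x, (k, i)}. expectation (\<lambda>\<omega>. h x \<omega> * h y \<omega>))"
      using P(1) \<open>(k, i) \<in> P\<close> that orth x by (intro sum.mono_neutral_right) auto
    also have "\<dots> \<le> (\<Sum>y\<in>{x, (k, i)}. R)"
    proof (rule sum_mono)
      fix y assume "y \<in> {x, (k, i)}"
      then have "y \<in> P" using that \<open>(k, i) \<in> P\<close> by auto
      then show "expectation (\<lambda>\<omega>. h x \<omega> * h y \<omega>) \<le> R"
        using Cauchy_Schwarz_bound[OF hL hL, of x y "sqrt R" "sqrt R"] hR that \<open>R \<ge> 0\<close> by simp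
    qed
    also have "\<dots> = 2 * R" using \<open>i \<noteq> k\<close> x by simp
    finally show ?thesis .
  qed
  have card: "real (card P) = real n * (real n - 1)"
    using \<open>n \<ge> 1\<close> by (simp add: P_def of_nat_diff)
  have eq: "(\<Sum>i\<in>{1..n}. \<Sum>k\<in>{1..n} - {i}. \<Sum>j\<in>J. a j (Z i \<omega>) * b j (Z k \<omega>)) = (\<Sum>x\<in>P. h x \<omega>)" for \<omega>
    unfolding P_def h_def by (subst sum.Sigma) (auto simp: case_prod_unfold)
  have "expectation (\<lambda>\<omega>. (\<Sum>x\<in>P. h x \<omega>)\<^sup>2) = (\<Sum>x\<in>P. \<Sum>y\<in>P. expectation (\<lambda>\<omega>. h x \<omega> * h y \<omega>))"
    by (rule expectation_square_sum[OF hL])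
  also have "\<dots> \<le> (\<Sum>x\<in>P. 2 * R)" by (rule sum_mono[OF row_sum])
  also have "\<dots> = 2 * R * (real n * (real n - 1))" using card by simp
  finally show "expectation (\<lambda>\<omega>. (\<Sum>i\<in>{1..n}. \<Sum>k\<in>{1..n} - {i}. \<Sum>j\<in>J. a j (Z i \<omega>) * b j (Z k \<omega>))\<^sup>2)
     \<le> 2 * R * (real n * (real n - 1))" unfolding eq .
  show "L2 (\<lambda>\<omega>. \<Sum>i\<in>{1..n}. \<Sum>k\<in>{1..n} - {i}. \<Sum>j\<in>J. a j (Z i \<omega>) * b j (Z k \<omega>))"
    unfolding eq by (rule L2_sum[OF hL])
qed

text \<open>
  Hoeffding's decomposition. With \<open>w = b + (w - b)\<close> and \<open>s = t + (s - t)\<close>, the product splits into a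
  degenerate part, the linear parts \<open>b (s - t)\<close> and \<open>t (w - b)\<close>, and the mean. The three fluctuating
  parts have second moments of order \<open>1 / n\<^sup>2\<close>, \<open>1 / n\<close> and \<open>1 / n\<close>.
\<close>

lemma cross_U_statistic_variance:
  fixes w s :: "'j \<Rightarrow> 'b \<Rightarrow> real" and b t :: "'j \<Rightarrow> real"
  assumes n: "n \<ge> 2"
    and w: "\<And>j. j \<in> J \<Longrightarrow> w j \<in> borel_measurable N" and s: "\<And>j. j \<in> J \<Longrightarrow> s j \<in> borel_measurable N"
    and wL: "\<And>j. j \<in> J \<Longrightarrow> L2 (\<lambda>\<omega>. w j (Z 1 \<omega>))" and sL: "\<And>j. j \<in> J \<Longrightarrow> L2 (\<lambda>\<omega>. s j (Z 1 \<omega>))"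
    and w_mean: "\<And>j. j \<in> J \<Longrightarrow> expectation (\<lambda>\<omega>. w j (Z 1 \<omega>)) = b j"
    and s_mean: "\<And>j. j \<in> J \<Longrightarrow> expectation (\<lambda>\<omega>. s j (Z 1 \<omega>)) = t j"
    and K: "\<And>u. expectation (\<lambda>\<omega>. (\<Sum>j\<in>J. u j * w j (Z 1 \<omega>))\<^sup>2) \<le> K * (\<Sum>j\<in>J. (u j)\<^sup>2)" and "K \<ge> 0"
    and B: "(\<Sum>j\<in>J. expectation (\<lambda>\<omega>. (s j (Z 1 \<omega>))\<^sup>2)) \<le> B"
    and D: "expectation (\<lambda>\<omega>. (\<Sum>j\<in>J. b j * s j (Z 1 \<omega>))\<^sup>2) \<le> D"
  shows "L2 (\<lambda>\<omega>. (\<Sum>i\<in>{1..n}. \<Sum>k\<in>{1..n} - {i}. \<Sum>j\<in>J. w j (Z i \<omega>) * s j (Z k \<omega>))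
        / (real n * (real n - 1))
        - (\<Sum>j\<in>J. b j * t j))"
    and "expectation (\<lambda>\<omega>. ((\<Sum>i\<in>{1..n}. \<Sum>k\<in>{1..n} - {i}. \<Sum>j\<in>J. w j (Z i \<omega>) * s j (Z k \<omega>))
        / (real n * (real n - 1))
        - (\<Sum>j\<in>J. b j * t j))\<^sup>2)
      \<le> 3 * (2 * K * B / (real n * (real n - 1)) + D / real n + K * (\<Sum>j\<in>J. (t j)\<^sup>2) / real n)"
proof -
  define m where "m = real n * (real n - 1)"
  have pos: "real n > 0" "real n - 1 > 0" "m > 0" using n by (auto simp: m_def)
  define \<mu> where "\<mu> = (\<Sum>j\<in>J. b j * t j)"
  define A where "A \<omega> = (\<Sum>i\<in>{1..n}. \<Sum>k\<in>{1..n} - {i}. \<Sum>j\<in>J. (w j (Z i \<omega>) - b j) * (s j (Z k \<omega>) - t j))" for \<omega>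
  define f where "f z = (\<Sum>j\<in>J. b j * s j z) - \<mu>" for z
  define h where "h z = (\<Sum>j\<in>J. t j * w j z) - \<mu>" for z
  define U where "U \<omega> = (\<Sum>i\<in>{1..n}. \<Sum>k\<in>{1..n} - {i}. \<Sum>j\<in>J. w j (Z i \<omega>) * s j (Z k \<omega>))" for \<omega>
  have sum_off1: "(\<Sum>i\<in>{1..n}. \<Sum>k\<in>{1..n} - {i}. c k) = (real n - 1) * (\<Sum>k=1..n. c k)" for c :: "nat \<Rightarrow> real"
  proof -
    have "(\<Sum>i\<in>{1..n}. \<Sum>k\<in>{1..n} - {i}. c k) = (\<Sum>i\<in>{1..n}. (\<Sum>k=1..n. c k) - c i)"
      by (intro sum.cong refl) (simp add: sum_diff1)
    also have "\<dots> = (real n - 1) * (\<Sum>k=1..n. c k)" by (simp add: sum_subtractf algebra_simps)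
    finally show ?thesis .
  qed
  have sum_off2: "(\<Sum>i\<in>{1..n}. \<Sum>k\<in>{1..n} - {i}. c i) = (real n - 1) * (\<Sum>k=1..n. c k)" for c :: "nat \<Rightarrow> real"
  proof -
    have "(\<Sum>i\<in>{1..n}. \<Sum>k\<in>{1..n} - {i}. c i) = (\<Sum>i\<in>{1..n}. (real n - 1) * c i)"
      using n by (intro sum.cong refl) (simp add: of_nat_diff)
    then show ?thesis by (simp add: sum_distrib_left)
  qed
  have decomp: "U \<omega> / m - \<mu> = A \<omega> / m + (\<Sum>k=1..n. f (Z k \<omega>)) / real n + (\<Sum>i=1..n. h (Z i \<omega>)) / real n" for \<omega>
  proof -
    have "(\<Sum>j\<in>J. w j (Z i \<omega>) * s j (Z k \<omega>))
      = (\<Sum>j\<in>J. (w j (Z i \<omega>) - b j) * (s j (Z k \<omega>) - t j)) + f (Z k \<omega>) + h (Z i \<omega>) + \<mu>" for i k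
      by (simp add: f_def h_def \<mu>_def algebra_simps sum.distrib sum_subtractf)
    then have "U \<omega> = A \<omega> + (real n - 1) * (\<Sum>k=1..n. f (Z k \<omega>)) + (real n - 1) * (\<Sum>i=1..n. h (Z i \<omega>))
        + (real n - 1) * (\<Sum>i=1..n. \<mu>)"
      unfolding U_def A_def
      by (simp only: sum.distrib sum_off1[of "\<lambda>k. f (Z k \<omega>)"] sum_off2[of "\<lambda>i. h (Z i \<omega>)"]
          sum_off1[of "\<lambda>_. \<mu>"])
    moreover have "real n - 1 = m / real n" using pos by (simp add: m_def)
    ultimately have "U \<omega> = A \<omega> + m * ((\<Sum>k=1..n. f (Z k \<omega>)) / real n) + m * ((\<Sum>i=1..n. h (Z i \<omega>)) / real n) + m * \<mu>"
      using pos by simp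
    then show ?thesis using pos by (simp add: add_divide_distrib)
  qed
  have fm: "f \<in> borel_measurable N" and hm: "h \<in> borel_measurable N"
    unfolding f_def h_def using w s by auto
  have fL0: "L2 (\<lambda>\<omega>. \<Sum>j\<in>J. b j * s j (Z 1 \<omega>))" and hL0: "L2 (\<lambda>\<omega>. \<Sum>j\<in>J. t j * w j (Z 1 \<omega>))"
    using wL sL by (auto intro!: L2_sum L2_cmult)
  then have fL: "L2 (\<lambda>\<omega>. f (Z 1 \<omega>))" and hL: "L2 (\<lambda>\<omega>. h (Z 1 \<omega>))"
    unfolding f_def h_def by (auto intro!: L2_diff)
  have f0: "expectation (\<lambda>\<omega>. f (Z 1 \<omega>)) = 0" and h0: "expectation (\<lambda>\<omega>. h (Z 1 \<omega>)) = 0"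
    unfolding f_def h_def \<mu>_def using wL sL
    by (simp_all add: L2_integrable w_mean s_mean prob_space mult.commute del: One_nat_def)
  have f2: "expectation (\<lambda>\<omega>. (f (Z 1 \<omega>))\<^sup>2) \<le> D"
    using expectation_square_centered_le[OF fL0, of \<mu>] D sL
    by (simp add: f_def \<mu>_def L2_integrable s_mean del: One_nat_def)
  have h2: "expectation (\<lambda>\<omega>. (h (Z 1 \<omega>))\<^sup>2) \<le> K * (\<Sum>j\<in>J. (t j)\<^sup>2)"
    using expectation_square_centered_le[OF hL0, of \<mu>] K[of t] wL
    by (simp add: h_def \<mu>_def L2_integrable w_mean mult.commute del: One_nat_def)
  have "(\<Sum>j\<in>J. expectation (\<lambda>\<omega>. (s j (Z 1 \<omega>) - t j)\<^sup>2)) \<le> (\<Sum>j\<in>J. expectation (\<lambda>\<omega>. (s j (Z 1 \<omega>))\<^sup>2))"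
    by (intro sum_mono expectation_square_centered_le sL s_mean)
  also note B
  finally have B': "K * (\<Sum>j\<in>J. expectation (\<lambda>\<omega>. (s j (Z 1 \<omega>) - t j)\<^sup>2)) \<le> K * B"
    using \<open>K \<ge> 0\<close> by (rule mult_left_mono)
  have "0 \<le> (\<Sum>j\<in>J. expectation (\<lambda>\<omega>. (s j (Z 1 \<omega>))\<^sup>2))" by (intro sum_nonneg) simp
  then have "K * B \<ge> 0" using \<open>K \<ge> 0\<close> B by simp
  have K': "expectation (\<lambda>\<omega>. (\<Sum>j\<in>J. u j * (w j (Z 1 \<omega>) - b j))\<^sup>2) \<le> K * (\<Sum>j\<in>J. (u j)\<^sup>2)" for u
  proof -
    have L: "L2 (\<lambda>\<omega>. \<Sum>j\<in>J. u j * w j (Z 1 \<omega>))" using wL by (auto intro!: L2_sum L2_cmult)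
    have "expectation (\<lambda>\<omega>. \<Sum>j\<in>J. u j * w j (Z 1 \<omega>)) = (\<Sum>j\<in>J. u j * b j)"
      using wL by (simp add: L2_integrable w_mean del: One_nat_def)
    from order_trans[OF expectation_square_centered_le[OF L this] K]
    show ?thesis by (simp add: right_diff_distrib sum_subtractf)
  qed
  have a: "(\<lambda>z. w j z - b j) \<in> borel_measurable N" "(\<lambda>z. s j z - t j) \<in> borel_measurable N"
    "L2 (\<lambda>\<omega>. w j (Z 1 \<omega>) - b j)" "L2 (\<lambda>\<omega>. s j (Z 1 \<omega>) - t j)"
    "expectation (\<lambda>\<omega>. w j (Z 1 \<omega>) - b j) = 0" "expectation (\<lambda>\<omega>. s j (Z 1 \<omega>) - t j) = 0"
    if "j \<in> J" for j
    using w[OF that] s[OF that] wL[OF that] sL[OF that] w_mean[OF that] s_mean[OF that]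
    by (auto simp: L2_integrable prob_space intro!: L2_diff)
  have "1 \<le> n" using n by simp
  note degenerate = expectation_square_degenerate_double_sum[of J "\<lambda>j z. w j z - b j" "\<lambda>j z. s j z - t j" K "K * B",
      OF a K' B' \<open>K * B \<ge> 0\<close> \<open>1 \<le> n\<close>]
  have A: "expectation (\<lambda>\<omega>. (A \<omega>)\<^sup>2) \<le> 2 * (K * B) * m"
    unfolding A_def m_def by (rule degenerate(1))
  have AL: "L2 A"
    unfolding A_def[abs_def] by (rule degenerate(2))
  have FL: "L2 (\<lambda>\<omega>. \<Sum>k=1..n. f (Z k \<omega>))" and HL: "L2 (\<lambda>\<omega>. \<Sum>k=1..n. h (Z k \<omega>))"
    using L2_Z[OF _ fm fL] L2_Z[OF _ hm hL] by (auto intro!: L2_sum)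
  have F2: "expectation (\<lambda>\<omega>. (\<Sum>k=1..n. f (Z k \<omega>))\<^sup>2) \<le> real n * D"
    using expectation_square_centered_sum[OF fm fL f0] f2 by (simp add: mult_left_mono)
  have H2: "expectation (\<lambda>\<omega>. (\<Sum>k=1..n. h (Z k \<omega>))\<^sup>2) \<le> real n * (K * (\<Sum>j\<in>J. (t j)\<^sup>2))"
    using expectation_square_centered_sum[OF hm hL h0] h2 by (simp add: mult_left_mono)
  have three: "(x + y + z)\<^sup>2 \<le> 3 * (x\<^sup>2 + y\<^sup>2 + z\<^sup>2)" for x y z :: real
    using zero_le_power2[of "x - y"] zero_le_power2[of "y - z"] zero_le_power2[of "x - z"]
    by (simp add: power2_eq_square algebra_simps)
  have UL: "L2 (\<lambda>\<omega>. U \<omega> / m - \<mu>)"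
    unfolding decomp using L2_add[OF L2_add[OF L2_cmult[OF AL, of "1 / m"] L2_cmult[OF FL, of "1 / real n"]]
        L2_cmult[OF HL, of "1 / real n"]] by simp
  have "expectation (\<lambda>\<omega>. (U \<omega> / m - \<mu>)\<^sup>2)
    \<le> expectation (\<lambda>\<omega>. 3 * ((A \<omega> / m)\<^sup>2 + ((\<Sum>k=1..n. f (Z k \<omega>)) / real n)\<^sup>2 + ((\<Sum>k=1..n. h (Z k \<omega>)) / real n)\<^sup>2))"
    unfolding decomp
  proof (intro integral_mono three)
    show "integrable M (\<lambda>\<omega>. (A \<omega> / m + (\<Sum>k=1..n. f (Z k \<omega>)) / real n + (\<Sum>i=1..n. h (Z i \<omega>)) / real n)\<^sup>2)"
      using UL by (simp add: L2_def decomp)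
  qed (use AL FL HL in \<open>simp add: power_divide L2_square\<close>)
  also have "\<dots> = 3 * (expectation (\<lambda>\<omega>. (A \<omega>)\<^sup>2) / m\<^sup>2 + expectation (\<lambda>\<omega>. (\<Sum>k=1..n. f (Z k \<omega>))\<^sup>2) / (real n)\<^sup>2
      + expectation (\<lambda>\<omega>. (\<Sum>k=1..n. h (Z k \<omega>))\<^sup>2) / (real n)\<^sup>2)"
    using AL FL HL by (simp add: power_divide L2_square)
  also have "\<dots> \<le> 3 * (2 * (K * B) * m / m\<^sup>2 + real n * D / (real n)\<^sup>2 + real n * (K * (\<Sum>j\<in>J. (t j)\<^sup>2)) / (real n)\<^sup>2)"
    by (intro mult_left_mono add_mono divide_right_mono A F2 H2) auto
  also have "\<dots> = 3 * (2 * K * B / m + D / real n + K * (\<Sum>j\<in>J. (t j)\<^sup>2) / real n)"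
    using pos by (simp add: power2_eq_square)
  finally show "expectation (\<lambda>\<omega>. ((\<Sum>i\<in>{1..n}. \<Sum>k\<in>{1..n} - {i}. \<Sum>j\<in>J. w j (Z i \<omega>) * s j (Z k \<omega>))
        / (real n * (real n - 1))
        - (\<Sum>j\<in>J. b j * t j))\<^sup>2)
      \<le> 3 * (2 * K * B / (real n * (real n - 1)) + D / real n + K * (\<Sum>j\<in>J. (t j)\<^sup>2) / real n)"
    by (simp add: U_def m_def \<mu>_def)
  show "L2 (\<lambda>\<omega>. (\<Sum>i\<in>{1..n}. \<Sum>k\<in>{1..n} - {i}. \<Sum>j\<in>J. w j (Z i \<omega>) * s j (Z k \<omega>))
        / (real n * (real n - 1))
        - (\<Sum>j\<in>J. b j * t j))"
    using UL by (simp add: U_def m_def \<mu>_def)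
qed

end

section \<open>Conditioning on the covariates\<close>

context linear_model
begin

definition obs :: "nat \<Rightarrow> 'a \<Rightarrow> (nat \<Rightarrow> real) \<times> real" where
  "obs i \<omega> = (row p X i \<omega>, Y i \<omega>)"

sublocale iid_sample M n "vec_borel p \<Otimes>\<^sub>M borel" obs
proof
  show "indep_vars (\<lambda>_. vec_borel p \<Otimes>\<^sub>M borel) obs {1..n}"
    unfolding obs_def by (rule independent_observations)
  show "distr M (vec_borel p \<Otimes>\<^sub>M borel) (obs i) = distr M (vec_borel p \<Otimes>\<^sub>M borel) (obs 1)"
    if "i \<in> {1..n}" for i
    unfolding obs_def by (rule identically_distributed[OF that])
qed

text \<open>
  The first observation has index \<open>1\<close>; rewriting this index to \<open>Suc 0\<close> would hide it from the facts
  stated about it.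
\<close>

context
  notes One_nat_def [simp del]
begin

lemma row_measurable: "i \<in> {1..n} \<Longrightarrow> row p X i \<in> measurable M (vec_borel p)"
  using measurable_compose[OF Z_measurable measurable_fst] by (simp add: obs_def[abs_def])

lemma response_measurable: "i \<in> {1..n} \<Longrightarrow> Y i \<in> borel_measurable M"
  using measurable_compose[OF Z_measurable measurable_snd] by (simp add: obs_def[abs_def])

definition row_algebra :: "'a measure" where
  "row_algebra = vimage_algebra (space M) (row p X 1) (vec_borel p)"

lemma row_subalgebra:
  assumes "n \<ge> 1"
  shows "sigma_finite_subalgebra M row_algebra"
proof (rule finite_measure_subalgebra_is_sigma_finite)
  have "row p X 1 \<in> measurable M (vec_borel p)" using row_measurable[of 1] assms by simp
  then have "subalgebra M row_algebra"
    unfolding subalgebra_def row_algebra_def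
    by (auto simp: sets_vimage_algebra2 measurable_space intro: measurable_sets)
  then show "finite_measure_subalgebra M row_algebra"
    by unfold_locales
qed

lemma row_algebra_measurable:
  assumes "n \<ge> 1" "f \<in> measurable (vec_borel p) L"
  shows "(\<lambda>\<omega>. f (row p X 1 \<omega>)) \<in> measurable row_algebra L"
proof -
  have "row p X 1 \<in> space M \<rightarrow> space (vec_borel p)"
    using assms by (intro Pi_I measurable_space[OF row_measurable]) auto
  then show ?thesis
    unfolding row_algebra_def by (rule measurable_compose[OF measurable_vimage_algebra1 assms(2)])
qed

lemma noise_L2: "i \<in> {1..n} \<Longrightarrow> L2 (\<epsilon> i)"
  using noise_square_integrable noise_integrable by (auto simp: L2_def)

text \<open>
  The defining property of conditional expectation, tested against a function of the covariates.
\<close>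

lemma noise_uncorrelated:
  assumes n: "n \<ge> 1" and f: "f \<in> borel_measurable (vec_borel p)" and L: "L2 (\<lambda>\<omega>. f (row p X 1 \<omega>))"
  shows "expectation (\<lambda>\<omega>. f (row p X 1 \<omega>) * \<epsilon> 1 \<omega>) = 0"
proof -
  interpret S: sigma_finite_subalgebra M row_algebra by (rule row_subalgebra[OF n])
  have i: "1 \<in> {1..n}" using n by simp
  have "expectation (\<lambda>\<omega>. f (row p X 1 \<omega>) * \<epsilon> 1 \<omega>)
      = expectation (\<lambda>\<omega>. f (row p X 1 \<omega>) * real_cond_exp M row_algebra (\<epsilon> 1) \<omega>)"
    using noise_L2[OF i] L f n
    by (intro S.real_cond_exp_intg(2)[symmetric] L2_mult_integrable row_algebra_measurable L2_measurable)
  also have "\<dots> = expectation (\<lambda>\<omega>. 0)"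
  proof (rule integral_cong_AE)
    show "(\<lambda>\<omega>. f (row p X 1 \<omega>) * real_cond_exp M row_algebra (\<epsilon> 1) \<omega>) \<in> borel_measurable M"
      using L2_measurable[OF L] by measurable
    show "AE \<omega> in M. f (row p X 1 \<omega>) * real_cond_exp M row_algebra (\<epsilon> 1) \<omega> = 0"
      using noise_mean[OF i] unfolding row_algebra_def by eventually_elim simp
  qed simp
  finally show ?thesis by simp
qed

text \<open>
  Integrability of the product is part of the claim, so the argument runs with nonnegative
  extended-real conditional expectations. The conditional second moment there is almost surely
  finite, which excludes that \<open>enn2real\<close> hides an infinite value.
\<close>

lemma noise_conditional_square:
  assumes n: "n \<ge> 1" and f: "f \<in> borel_measurable (vec_borel p)" and nonneg: "\<And>x. f x \<ge> 0"
    and int: "integrable M (\<lambda>\<omega>. f (row p X 1 \<omega>))"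
  shows "integrable M (\<lambda>\<omega>. f (row p X 1 \<omega>) * (\<epsilon> 1 \<omega>)\<^sup>2)"
    and "expectation (\<lambda>\<omega>. f (row p X 1 \<omega>) * (\<epsilon> 1 \<omega>)\<^sup>2) = \<sigma>\<^sup>2 * expectation (\<lambda>\<omega>. f (row p X 1 \<omega>))"
proof -
  interpret S: sigma_finite_subalgebra M row_algebra by (rule row_subalgebra[OF n])
  have i: "1 \<in> {1..n}" using n by simp
  define F where "F = (\<lambda>\<omega>. f (row p X 1 \<omega>))"
  have [measurable]: "F \<in> borel_measurable row_algebra" "F \<in> borel_measurable M" "\<epsilon> 1 \<in> borel_measurable M"
    unfolding F_def using row_algebra_measurable[OF n f] int L2_measurable[OF noise_L2[OF i]] by auto
  define c where "c = nn_cond_exp M row_algebra (\<lambda>\<omega>. ennreal ((\<epsilon> 1 \<omega>)\<^sup>2))"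
  have [measurable]: "c \<in> borel_measurable M" unfolding c_def by measurable
  have "(\<integral>\<^sup>+ \<omega>. c \<omega> \<partial>M) = (\<integral>\<^sup>+ \<omega>. 1 * c \<omega> \<partial>M)" by simp
  also have "\<dots> = (\<integral>\<^sup>+ \<omega>. 1 * ennreal ((\<epsilon> 1 \<omega>)\<^sup>2) \<partial>M)"
    unfolding c_def by (rule S.nn_cond_exp_intg) auto
  also have "\<dots> = ennreal (expectation (\<lambda>\<omega>. (\<epsilon> 1 \<omega>)\<^sup>2))"
    using noise_square_integrable[OF i] by (simp add: nn_integral_eq_integral)
  finally have finite: "AE \<omega> in M. c \<omega> \<noteq> \<infinity>"
    by (intro nn_integral_PInf_AE) auto
  \<comment> \<open>The real conditional expectation is a difference of two parts; for \<open>\<epsilon>\<^sup>2\<close> the second one vanishes.\<close>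
  have neg0: "AE \<omega> in M. nn_cond_exp M row_algebra (\<lambda>\<omega>. ennreal (- ((\<epsilon> 1 \<omega>)\<^sup>2))) \<omega> = 0"
  proof -
    have "(\<lambda>\<omega>. ennreal (- ((\<epsilon> 1 \<omega>)\<^sup>2))) = (\<lambda>_. 0)" by (auto simp: ennreal_neg)
    then show ?thesis using S.nn_cond_exp_F_meas[of "\<lambda>_. 0"] by simp
  qed
  have ceq: "AE \<omega> in M. c \<omega> = ennreal (\<sigma>\<^sup>2)"
    using finite neg0 noise_variance[OF i]
  proof eventually_elim
    case (elim \<omega>)
    then have "enn2real (c \<omega>) = \<sigma>\<^sup>2"
      by (simp add: real_cond_exp_def c_def row_algebra_def)
    then show ?case using elim(1) by (metis ennreal_enn2real infinity_ennreal_def less_top)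
  qed
  have "(\<integral>\<^sup>+ \<omega>. ennreal (F \<omega> * (\<epsilon> 1 \<omega>)\<^sup>2) \<partial>M) = (\<integral>\<^sup>+ \<omega>. ennreal (F \<omega>) * ennreal ((\<epsilon> 1 \<omega>)\<^sup>2) \<partial>M)"
    using nonneg by (simp add: F_def ennreal_mult)
  also have "\<dots> = (\<integral>\<^sup>+ \<omega>. ennreal (F \<omega>) * c \<omega> \<partial>M)"
    unfolding c_def by (rule S.nn_cond_exp_intg[symmetric]) auto
  also have "\<dots> = (\<integral>\<^sup>+ \<omega>. ennreal (F \<omega>) * ennreal (\<sigma>\<^sup>2) \<partial>M)"
    by (rule nn_integral_cong_AE) (use ceq in eventually_elim, simp)
  also have "\<dots> = (\<integral>\<^sup>+ \<omega>. ennreal (F \<omega> * \<sigma>\<^sup>2) \<partial>M)"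
    using nonneg by (simp add: F_def ennreal_mult)
  also have "\<dots> = ennreal (expectation (\<lambda>\<omega>. F \<omega> * \<sigma>\<^sup>2))"
    using int nonneg by (intro nn_integral_eq_integral) (auto simp: F_def)
  finally have eq: "(\<integral>\<^sup>+ \<omega>. ennreal (F \<omega> * (\<epsilon> 1 \<omega>)\<^sup>2) \<partial>M) = ennreal (\<sigma>\<^sup>2 * expectation F)"
    by (simp add: mult.commute)
  have nn: "0 \<le> \<sigma>\<^sup>2 * expectation F" using nonneg by (simp add: F_def)
  have nnF: "F \<omega> * (\<epsilon> 1 \<omega>)\<^sup>2 \<ge> 0" for \<omega> using nonneg by (simp add: F_def)
  show "integrable M (\<lambda>\<omega>. f (row p X 1 \<omega>) * (\<epsilon> 1 \<omega>)\<^sup>2)"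
  proof -
    have "integrable M (\<lambda>\<omega>. F \<omega> * (\<epsilon> 1 \<omega>)\<^sup>2)"
      by (rule integrableI_nn_integral_finite[OF _ _ eq]) (use nnF in auto)
    then show ?thesis by (simp add: F_def)
  qed
  show "expectation (\<lambda>\<omega>. f (row p X 1 \<omega>) * (\<epsilon> 1 \<omega>)\<^sup>2) = \<sigma>\<^sup>2 * expectation (\<lambda>\<omega>. f (row p X 1 \<omega>))"
  proof -
    have "expectation (\<lambda>\<omega>. F \<omega> * (\<epsilon> 1 \<omega>)\<^sup>2) = \<sigma>\<^sup>2 * expectation F"
      by (subst integral_eq_nn_integral) (use nnF nn in \<open>auto simp: eq\<close>)
    then show ?thesis by (simp add: F_def)
  qed
qed

end

end

section \<open>Moments of the covariates\<close>

lemma pair_sum_Suc: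
  fixes x :: "nat \<Rightarrow> real"
  shows "(\<Sum>j=1..Suc m. \<Sum>k=j+1..Suc m. x j * x k) = (\<Sum>j=1..m. \<Sum>k=j+1..m. x j * x k) + (\<Sum>j=1..m. x j) * x (Suc m)"
proof -
  have "(\<Sum>j=1..Suc m. \<Sum>k=j+1..Suc m. x j * x k) = (\<Sum>j=1..m. (\<Sum>k=j+1..m. x j * x k) + x j * x (Suc m))"
    by simp
  then show ?thesis by (simp add: sum.distrib sum_distrib_right)
qed

text \<open>
  Expresses \<open>g\<close> through a linear form and a sum of squares, so that its moments need no separate
  theory of quadratic forms.
\<close>

lemma square_sum_eq_squares_plus_pairs:
  fixes x :: "nat \<Rightarrow> real"
  shows "(\<Sum>j=1..m. x j)\<^sup>2 = (\<Sum>j=1..m. (x j)\<^sup>2) + 2 * (\<Sum>j=1..m. \<Sum>k=j+1..m. x j * x k)"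
proof (induction m)
  case (Suc m)
  have "(\<Sum>j=1..Suc m. x j)\<^sup>2 = (\<Sum>j=1..m. x j)\<^sup>2 + (x (Suc m))\<^sup>2 + 2 * ((\<Sum>j=1..m. x j) * x (Suc m))"
    by (simp add: power2_sum)
  then show ?case unfolding Suc pair_sum_Suc by simp
qed simp

text \<open>
  The model at a single sample size. The constant \<open>C\<close> will be the same for all sample sizes, and
  every bound below is explicit in \<open>C\<close>, \<open>n\<close>, \<open>p\<close> and the parameters of the model.
\<close>

locale independent_columns_model = linear_model M n p X Y \<epsilon> \<beta> \<sigma>
  for M :: "'a measure" and n p X Y \<epsilon> \<beta> \<sigma> +
  fixes C :: real
  assumes sample_nonempty: "1 \<le> n"
    and columns: "independent_columns M n p X"
    and eighth_moment_integrable: "\<And>j. j \<in> {1..p} \<Longrightarrow> integrable M (\<lambda>\<omega>. X 1 j \<omega> ^ 8)"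
    and eighth_moment_le: "\<And>j. j \<in> {1..p} \<Longrightarrow> expectation (\<lambda>\<omega>. X 1 j \<omega> ^ 8) \<le> C"
    and C_nonneg: "0 \<le> C"
begin

context
  notes One_nat_def [simp del]
begin

text \<open>The constant of the eighth moment bound, for unit variances.\<close>

definition \<kappa> :: real where "\<kappa> = 247 * (1 + C)"

text \<open>The variance of a response.\<close>

definition \<rho> :: real where "\<rho> = signal_level p \<beta> + \<sigma>\<^sup>2"

definition lin :: "(nat \<Rightarrow> real) \<Rightarrow> 'a \<Rightarrow> real" where
  "lin u \<omega> = (\<Sum>j=1..p. u j * X 1 j \<omega>)"

lemma kappa_ge_1: "1 \<le> \<kappa>" and C_le_kappa: "C \<le> \<kappa>"
  using C_nonneg by (auto simp: \<kappa>_def)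

lemma signal_level_nonneg: "0 \<le> signal_level m u"
  by (simp add: signal_level_def sum_nonneg)

lemma rho_nonneg: "0 \<le> \<rho>" and signal_le_rho: "signal_level p \<beta> \<le> \<rho>"
  using signal_level_nonneg[of p \<beta>] by (auto simp: \<rho>_def)

lemma first_observation: "1 \<in> {1..n}"
  using sample_nonempty by simp

lemma entries_independent: "indep_vars (\<lambda>_. borel) (X 1) {1..p}"
proof -
  have c: "indep_vars (\<lambda>_. vec_borel n) (column n X) {1..p}"
    using columns by (simp add: independent_columns_def)
  have "indep_vars (\<lambda>_. borel) (\<lambda>j \<omega>. column n X j \<omega> 1) {1..p}"
    by (rule indep_vars_compose2[OF c, of "\<lambda>_ c. c 1"])
      (rule measurable_component_singleton[OF first_observation])
  then show ?thesis using first_observation by (simp add: column_def)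
qed

lemma entry_measurable: "j \<in> {1..p} \<Longrightarrow> X 1 j \<in> borel_measurable M"
  using entries_independent by (simp add: indep_vars_def)

lemma entry_L2: "j \<in> {1..p} \<Longrightarrow> L2 (X 1 j)"
  using covariate_product_integrable[OF first_observation, of j j] entry_measurable
  by (simp add: L2_def power2_eq_square)

lemma entry_covariance:
  "j \<in> {1..p} \<Longrightarrow> k \<in> {1..p} \<Longrightarrow> expectation (\<lambda>\<omega>. X 1 j \<omega> * X 1 k \<omega>) = (if j = k then 1 else 0)"
  using covariate_cov[OF first_observation, of j k] by (simp add: covariate_mean[OF first_observation])

lemma lin_measurable [measurable]: "lin u \<in> borel_measurable M"
  unfolding lin_def[abs_def] using entry_measurable by (intro borel_measurable_sum borel_measurable_times) auto

lemma lin_eighth_moment: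
  shows integrable_lin_eighth: "integrable M (\<lambda>\<omega>. lin u \<omega> ^ 8)"
    and lin_eighth_le: "expectation (\<lambda>\<omega>. lin u \<omega> ^ 8) \<le> (\<kappa> * signal_level p u) ^ 4"
proof -
  have ind: "indep_vars (\<lambda>_. borel) (\<lambda>j \<omega>. u j * X 1 j \<omega>) {1..p}"
    using indep_vars_compose2[OF entries_independent, of "\<lambda>j x. u j * x" "\<lambda>_. borel"] by simp
  have V8: "integrable M (\<lambda>\<omega>. (u j * X 1 j \<omega>) ^ 8)" if "j \<in> {1..p}" for j
    using eighth_moment_integrable[OF that] by (simp add: power_mult_distrib)
  have mean: "expectation (\<lambda>\<omega>. u j * X 1 j \<omega>) = 0" if "j \<in> {1..p}" for j
    using covariate_mean[OF first_observation that] by simp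
  have sq: "expectation (\<lambda>\<omega>. (u j * X 1 j \<omega>)\<^sup>2) \<le> (u j)\<^sup>2" if "j \<in> {1..p}" for j
    using entry_covariance[OF that that] by (simp add: power_mult_distrib flip: power2_eq_square)
  have eight: "expectation (\<lambda>\<omega>. (u j * X 1 j \<omega>) ^ 8) \<le> C * ((u j)\<^sup>2) ^ 4" if "j \<in> {1..p}" for j
    using mult_left_mono[OF eighth_moment_le[OF that], of "u j ^ 8"]
    by (simp add: power_mult_distrib mult.commute flip: power_mult)
  note * = eighth_moment_independent_sum[OF _ ind V8 mean sq eight C_nonneg]
  show "integrable M (\<lambda>\<omega>. lin u \<omega> ^ 8)"
    and "expectation (\<lambda>\<omega>. lin u \<omega> ^ 8) \<le> (\<kappa> * signal_level p u) ^ 4"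
    unfolding lin_def \<kappa>_def signal_level_def by (rule *; simp)+
qed

lemma lin_power_L2: "m \<le> 4 \<Longrightarrow> L2 (\<lambda>\<omega>. lin u \<omega> ^ m)"
  using integrable_power_le_eight[OF lin_measurable integrable_lin_eighth, of "m * 2" u]
  by (simp add: L2_def power_mult)

text \<open>
  The lower moments carry the same constant \<open>\<kappa>\<close>, which enters once for each pair of factors \<open>lin u\<close>.
\<close>

lemma lin_moments:
  shows lin_second_le: "expectation (\<lambda>\<omega>. (lin u \<omega>)\<^sup>2) \<le> \<kappa> * signal_level p u"
    and lin_fourth_le: "expectation (\<lambda>\<omega>. lin u \<omega> ^ 4) \<le> (\<kappa> * signal_level p u)\<^sup>2"
  using moments_le_eighth[OF lin_measurable integrable_lin_eighth lin_eighth_le, of u]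
    kappa_ge_1 signal_level_nonneg[of p u] by auto

lemma lin_square_mult_L2: "L2 (\<lambda>\<omega>. (lin u \<omega>)\<^sup>2 * (lin v \<omega>)\<^sup>2)"
  using L2_mult_integrable[OF lin_power_L2[of 4 u] lin_power_L2[of 4 v]]
  by (simp add: L2_def power_mult_distrib flip: power_mult)

lemma lin_square_mult_le:
  shows "expectation (\<lambda>\<omega>. (lin u \<omega>)\<^sup>2 * (lin v \<omega>)\<^sup>2) \<le> (\<kappa> * signal_level p u) * (\<kappa> * signal_level p v)"
    and "expectation (\<lambda>\<omega>. ((lin u \<omega>)\<^sup>2 * (lin v \<omega>)\<^sup>2)\<^sup>2) \<le> ((\<kappa> * signal_level p u) * (\<kappa> * signal_level p v))\<^sup>2"
proof -
  have nn: "0 \<le> \<kappa> * signal_level p u" for u using kappa_ge_1 signal_level_nonneg[of p u] by simp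
  show "expectation (\<lambda>\<omega>. (lin u \<omega>)\<^sup>2 * (lin v \<omega>)\<^sup>2) \<le> (\<kappa> * signal_level p u) * (\<kappa> * signal_level p v)"
    using lin_fourth_le
    by (intro Cauchy_Schwarz_bound lin_power_L2 nn) (simp_all flip: power_mult)
  have "expectation (\<lambda>\<omega>. lin u \<omega> ^ 4 * lin v \<omega> ^ 4) \<le> (\<kappa> * signal_level p u)\<^sup>2 * (\<kappa> * signal_level p v)\<^sup>2"
    using lin_eighth_le
    by (intro Cauchy_Schwarz_bound lin_power_L2) (simp_all flip: power_mult)
  then show "expectation (\<lambda>\<omega>. ((lin u \<omega>)\<^sup>2 * (lin v \<omega>)\<^sup>2)\<^sup>2) \<le> ((\<kappa> * signal_level p u) * (\<kappa> * signal_level p v))\<^sup>2"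
    by (simp add: power_mult_distrib flip: power_mult)
qed

lemma g_measurable: "i \<in> {1..n} \<Longrightarrow> g p X i \<in> borel_measurable M"
  unfolding g_def[abs_def] using covariate_integrable[of i]
  by (intro borel_measurable_sum borel_measurable_times borel_measurable_integrable) auto

text \<open>
  From \<open>2 g = L\<^sup>2 - Q\<close>, with \<open>L\<close> the sum of the entries of the row and \<open>Q\<close> the sum of their squares,
  convexity gives \<open>g\<^sup>4 \<le> (L\<^sup>8 + Q\<^sup>4) / 2\<close>. The power-mean inequality bounds \<open>Q\<^sup>4\<close> by \<open>p\<^sup>3\<close> times the
  sum of the eighth powers.
\<close>

lemma g_fourth_moment:
  shows integrable_g_fourth: "integrable M (\<lambda>\<omega>. g p X 1 \<omega> ^ 4)"
    and g_fourth_le: "expectation (\<lambda>\<omega>. g p X 1 \<omega> ^ 4) \<le> (\<kappa> * real p) ^ 4"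
proof -
  define L where "L = lin (\<lambda>_. 1)"
  have L8: "integrable M (\<lambda>\<omega>. L \<omega> ^ 8)" "expectation (\<lambda>\<omega>. L \<omega> ^ 8) \<le> (\<kappa> * real p) ^ 4"
    using integrable_lin_eighth[of "\<lambda>_. 1"] lin_eighth_le[of "\<lambda>_. 1"]
    by (simp_all add: L_def signal_level_def)
  have bound: "g p X 1 \<omega> ^ 4 \<le> (L \<omega> ^ 8 + real p ^ 3 * (\<Sum>j=1..p. X 1 j \<omega> ^ 8)) / 2" for \<omega>
  proof -
    define Q where "Q = (\<Sum>j=1..p. (X 1 j \<omega>)\<^sup>2)"
    have "(L \<omega>)\<^sup>2 = Q + 2 * g p X 1 \<omega>"
      using square_sum_eq_squares_plus_pairs[of "\<lambda>j. X 1 j \<omega>" p]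
      by (simp add: L_def lin_def Q_def g_def)
    then have g: "g p X 1 \<omega> = ((L \<omega>)\<^sup>2 - Q) / 2" by simp
    have conv: "((x - y) / 2) ^ 4 \<le> (x ^ 4 + y ^ 4) / 2" for x y :: real
    proof -
      have sq: "((x - y) / 2)\<^sup>2 \<le> (x\<^sup>2 + y\<^sup>2) / 2" for x y :: real
        using zero_le_power2[of "x + y"] by (simp add: power2_eq_square field_simps)
      have sq': "((x + y) / 2)\<^sup>2 \<le> (x\<^sup>2 + y\<^sup>2) / 2" for x y :: real
        using zero_le_power2[of "x - y"] by (simp add: power2_eq_square field_simps)
      have "(((x - y) / 2)\<^sup>2)\<^sup>2 \<le> ((x\<^sup>2 + y\<^sup>2) / 2)\<^sup>2" by (intro power_mono sq) simp
      also have "\<dots> \<le> ((x\<^sup>2)\<^sup>2 + (y\<^sup>2)\<^sup>2) / 2" by (rule sq')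
      finally show ?thesis by (simp only: power_mult[symmetric]) simp
    qed
    have "Q\<^sup>2 \<le> real p * (\<Sum>j=1..p. X 1 j \<omega> ^ 4)"
      using sum_squared_le_sum_of_squares[of "\<lambda>j. (X 1 j \<omega>)\<^sup>2" "{1..p}"]
      by (simp add: Q_def mult.commute flip: power_mult)
    then have "(Q\<^sup>2)\<^sup>2 \<le> (real p * (\<Sum>j=1..p. X 1 j \<omega> ^ 4))\<^sup>2"
      by (intro power_mono) simp_all
    also have "\<dots> \<le> (real p)\<^sup>2 * (real p * (\<Sum>j=1..p. X 1 j \<omega> ^ 8))"
      unfolding power_mult_distrib
      using sum_squared_le_sum_of_squares[of "\<lambda>j. X 1 j \<omega> ^ 4" "{1..p}"]
      by (intro mult_left_mono) (simp_all add: mult.commute flip: power_mult)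
    also have "\<dots> = real p ^ 3 * (\<Sum>j=1..p. X 1 j \<omega> ^ 8)"
      by (simp add: power2_eq_square power3_eq_cube)
    also have "(Q\<^sup>2)\<^sup>2 = Q ^ 4" by (simp flip: power_mult)
    finally have Q4: "Q ^ 4 \<le> real p ^ 3 * (\<Sum>j=1..p. X 1 j \<omega> ^ 8)" .
    have "g p X 1 \<omega> ^ 4 \<le> (((L \<omega>)\<^sup>2) ^ 4 + Q ^ 4) / 2"
      unfolding g by (rule conv)
    also have "((L \<omega>)\<^sup>2) ^ 4 = L \<omega> ^ 8" by (simp flip: power_mult)
    finally show ?thesis using Q4 by simp
  qed
  have int: "integrable M (\<lambda>\<omega>. (L \<omega> ^ 8 + real p ^ 3 * (\<Sum>j=1..p. X 1 j \<omega> ^ 8)) / 2)"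
    by (intro integrable_divide Bochner_Integration.integrable_add L8 integrable_mult_right
        Bochner_Integration.integrable_sum eighth_moment_integrable)
  show int4: "integrable M (\<lambda>\<omega>. g p X 1 \<omega> ^ 4)"
  proof (rule Bochner_Integration.integrable_bound[OF int _ AE_I2])
    show "(\<lambda>\<omega>. g p X 1 \<omega> ^ 4) \<in> borel_measurable M"
      using g_measurable[OF first_observation] by simp
    show "norm (g p X 1 \<omega> ^ 4) \<le> norm ((L \<omega> ^ 8 + real p ^ 3 * (\<Sum>j=1..p. X 1 j \<omega> ^ 8)) / 2)" for \<omega>
    proof -
      have "norm (g p X 1 \<omega> ^ 4) = g p X 1 \<omega> ^ 4" by simp
      then show ?thesis using order_trans[OF bound[of \<omega>] abs_ge_self] by (simp only: real_norm_def)
    qed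
  qed
  have "expectation (\<lambda>\<omega>. g p X 1 \<omega> ^ 4) \<le> expectation (\<lambda>\<omega>. (L \<omega> ^ 8 + real p ^ 3 * (\<Sum>j=1..p. X 1 j \<omega> ^ 8)) / 2)"
    by (rule integral_mono[OF int4 int bound])
  also have "\<dots> = (expectation (\<lambda>\<omega>. L \<omega> ^ 8) + real p ^ 3 * (\<Sum>j=1..p. expectation (\<lambda>\<omega>. X 1 j \<omega> ^ 8))) / 2"
    using L8 eighth_moment_integrable by (simp del: atLeastAtMost_iff)
  also have "\<dots> \<le> ((\<kappa> * real p) ^ 4 + real p ^ 3 * (\<Sum>j=1..p. C)) / 2"
    by (intro divide_right_mono add_mono mult_left_mono sum_mono L8 eighth_moment_le) auto
  also have "\<dots> = ((\<kappa> * real p) ^ 4 + C * real p ^ 4) / 2"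
    by (simp add: power3_eq_cube power4_eq_xxxx)
  also have "\<dots> \<le> ((\<kappa> * real p) ^ 4 + \<kappa> ^ 4 * real p ^ 4) / 2"
    using C_le_kappa self_le_power[OF kappa_ge_1, of 4]
    by (intro divide_right_mono add_mono mult_right_mono) auto
  also have "\<dots> = (\<kappa> * real p) ^ 4" by (simp add: power_mult_distrib)
  finally show "expectation (\<lambda>\<omega>. g p X 1 \<omega> ^ 4) \<le> (\<kappa> * real p) ^ 4" .
qed

lemma g_square_L2: "L2 (\<lambda>\<omega>. (g p X 1 \<omega>)\<^sup>2)"
  using integrable_g_fourth g_measurable[OF first_observation] by (simp add: L2_def flip: power_mult)

lemma g_square_second_moment: "expectation (\<lambda>\<omega>. ((g p X 1 \<omega>)\<^sup>2)\<^sup>2) \<le> ((\<kappa> * real p)\<^sup>2)\<^sup>2"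
  using g_fourth_le by (simp flip: power_mult)

lemma lin_square_g_square_le:
  "expectation (\<lambda>\<omega>. (lin u \<omega>)\<^sup>2 * (g p X 1 \<omega>)\<^sup>2) \<le> (\<kappa> * signal_level p u) * (\<kappa> * real p)\<^sup>2"
  using lin_fourth_le[of u] kappa_ge_1 signal_level_nonneg[of p u]
  by (intro Cauchy_Schwarz_bound lin_power_L2 g_square_L2 g_square_second_moment) (simp_all flip: power_mult)

lemma lin_square_mult_g_square_le:
  "expectation (\<lambda>\<omega>. (lin u \<omega>)\<^sup>2 * (lin v \<omega>)\<^sup>2 * (g p X 1 \<omega>)\<^sup>2)
    \<le> ((\<kappa> * signal_level p u) * (\<kappa> * signal_level p v)) * (\<kappa> * real p)\<^sup>2"
  using kappa_ge_1 signal_level_nonneg[of p]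
  by (intro Cauchy_Schwarz_bound lin_square_mult_L2 g_square_L2 g_square_second_moment lin_square_mult_le) simp_all

section \<open>Moments of the response\<close>

text \<open>
  The quadratic form behind \<open>g\<close>, as a function of a row alone; the conditional moments of the
  noise and the distribution of the observations are available for such functions.
\<close>

definition pair_sum :: "(nat \<Rightarrow> real) \<Rightarrow> real" where
  "pair_sum r = (\<Sum>j=1..p. \<Sum>k=j+1..p. r j * r k)"

lemma component_measurable: "j \<in> {1..p} \<Longrightarrow> (\<lambda>r. r j) \<in> borel_measurable (vec_borel p)"
  by (rule measurable_component_singleton)

lemma pair_sum_measurable: "pair_sum \<in> borel_measurable (vec_borel p)"
  unfolding pair_sum_def[abs_def]
  by (intro borel_measurable_sum borel_measurable_times component_measurable) auto

lemma linear_form_measurable: "(\<lambda>r. \<Sum>j=1..p. u j * r j) \<in> borel_measurable (vec_borel p)"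
  by (intro borel_measurable_sum borel_measurable_times component_measurable borel_measurable_const) auto

lemma pair_sum_row: "pair_sum (row p X i \<omega>) = g p X i \<omega>"
  unfolding pair_sum_def g_def row_def by (intro sum.cong refl) auto

lemma linear_form_row: "(\<Sum>j=1..p. u j * row p X 1 \<omega> j) = lin u \<omega>"
  unfolding lin_def row_def by (intro sum.cong refl) auto

lemma g_L2: "L2 (g p X 1)"
  using g_measurable[OF first_observation] L2_integrable[OF g_square_L2] by (simp add: L2_def)

lemma response_first: "\<omega> \<in> space M \<Longrightarrow> Y 1 \<omega> = lin \<beta> \<omega> + \<epsilon> 1 \<omega>"
  using response[OF first_observation] by (simp add: lin_def)

text \<open>
  From \<open>Y\<^sup>2 \<le> 2 (lin \<beta>)\<^sup>2 + 2 \<epsilon>\<^sup>2\<close>: the first part is a moment of the covariates, and in the second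
  the noise may be replaced by its conditional variance.
\<close>

lemma weighted_response_square:
  assumes f: "f \<in> borel_measurable (vec_borel p)" and nonneg: "\<And>r. 0 \<le> f r"
    and int: "integrable M (\<lambda>\<omega>. f (row p X 1 \<omega>))"
    and int_lin: "integrable M (\<lambda>\<omega>. f (row p X 1 \<omega>) * (lin \<beta> \<omega>)\<^sup>2)"
    and le: "expectation (\<lambda>\<omega>. f (row p X 1 \<omega>)) \<le> a"
    and le_lin: "expectation (\<lambda>\<omega>. f (row p X 1 \<omega>) * (lin \<beta> \<omega>)\<^sup>2) \<le> a * signal_level p \<beta>"
  shows "integrable M (\<lambda>\<omega>. f (row p X 1 \<omega>) * (Y 1 \<omega>)\<^sup>2)"
    and "expectation (\<lambda>\<omega>. f (row p X 1 \<omega>) * (Y 1 \<omega>)\<^sup>2) \<le> 2 * a * \<rho>"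
proof -
  note noise = noise_conditional_square[OF sample_nonempty f nonneg int]
  define h where "h \<omega> = 2 * (f (row p X 1 \<omega>) * (lin \<beta> \<omega>)\<^sup>2) + 2 * (f (row p X 1 \<omega>) * (\<epsilon> 1 \<omega>)\<^sup>2)" for \<omega>
  have h: "integrable M h" unfolding h_def using int_lin noise(1) by simp
  have le_h: "f (row p X 1 \<omega>) * (Y 1 \<omega>)\<^sup>2 \<le> h \<omega>" if "\<omega> \<in> space M" for \<omega>
  proof -
    have "(Y 1 \<omega>)\<^sup>2 \<le> 2 * (lin \<beta> \<omega>)\<^sup>2 + 2 * (\<epsilon> 1 \<omega>)\<^sup>2"
      unfolding response_first[OF that] using zero_le_power2[of "lin \<beta> \<omega> - \<epsilon> 1 \<omega>"]
      by (simp add: power2_sum power2_diff)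
    from mult_left_mono[OF this nonneg[of "row p X 1 \<omega>"]] show ?thesis
      by (simp add: h_def algebra_simps)
  qed
  show int_Y: "integrable M (\<lambda>\<omega>. f (row p X 1 \<omega>) * (Y 1 \<omega>)\<^sup>2)"
  proof (rule Bochner_Integration.integrable_bound[OF h _ AE_I2])
    show "(\<lambda>\<omega>. f (row p X 1 \<omega>) * (Y 1 \<omega>)\<^sup>2) \<in> borel_measurable M"
      using borel_measurable_integrable[OF int] response_measurable[OF first_observation]
      by (intro borel_measurable_times borel_measurable_power)
    show "norm (f (row p X 1 \<omega>) * (Y 1 \<omega>)\<^sup>2) \<le> norm (h \<omega>)" if "\<omega> \<in> space M" for \<omega>
      using le_h[OF that] nonneg[of "row p X 1 \<omega>"] by simp
  qed
  have "expectation (\<lambda>\<omega>. f (row p X 1 \<omega>) * (Y 1 \<omega>)\<^sup>2) \<le> expectation h"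
    by (rule integral_mono[OF int_Y h le_h])
  also have "\<dots> = 2 * expectation (\<lambda>\<omega>. f (row p X 1 \<omega>) * (lin \<beta> \<omega>)\<^sup>2)
      + 2 * (\<sigma>\<^sup>2 * expectation (\<lambda>\<omega>. f (row p X 1 \<omega>)))"
    unfolding h_def[abs_def] using int_lin noise by simp
  also have "\<dots> \<le> 2 * (a * signal_level p \<beta>) + 2 * (\<sigma>\<^sup>2 * a)"
    by (intro add_mono mult_left_mono le le_lin) auto
  also have "\<dots> = 2 * a * \<rho>" by (simp add: \<rho>_def algebra_simps)
  finally show "expectation (\<lambda>\<omega>. f (row p X 1 \<omega>) * (Y 1 \<omega>)\<^sup>2) \<le> 2 * a * \<rho>" .
qed

text \<open>
  This bounds the operator norm of the second moment matrix of the vector \<open>W\<close> uniformly in \<open>p\<close>.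
\<close>

lemma lin_response:
  shows lin_response_L2: "L2 (\<lambda>\<omega>. lin u \<omega> * Y 1 \<omega>)"
    and lin_response_le: "expectation (\<lambda>\<omega>. (lin u \<omega> * Y 1 \<omega>)\<^sup>2) \<le> 2 * \<kappa>\<^sup>2 * \<rho> * signal_level p u"
proof -
  have "\<kappa> * signal_level p u \<le> \<kappa>\<^sup>2 * signal_level p u"
    using kappa_ge_1 signal_level_nonneg[of p u] by (intro mult_right_mono self_le_power) auto
  then have E: "expectation (\<lambda>\<omega>. (lin u \<omega>)\<^sup>2) \<le> \<kappa>\<^sup>2 * signal_level p u"
    using lin_second_le[of u] by simp
  have E': "expectation (\<lambda>\<omega>. (lin u \<omega>)\<^sup>2 * (lin \<beta> \<omega>)\<^sup>2) \<le> \<kappa>\<^sup>2 * signal_level p u * signal_level p \<beta>"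
    using lin_square_mult_le(1)[of u \<beta>] by (simp add: power2_eq_square ac_simps)
  have meas: "(\<lambda>r. (\<Sum>j=1..p. u j * r j)\<^sup>2) \<in> borel_measurable (vec_borel p)"
    by (intro borel_measurable_power linear_form_measurable)
  note * = weighted_response_square[OF meas, unfolded linear_form_row, OF _ _ _ E E']
  have "integrable M (\<lambda>\<omega>. (lin u \<omega>)\<^sup>2 * (Y 1 \<omega>)\<^sup>2)"
    and le: "expectation (\<lambda>\<omega>. (lin u \<omega>)\<^sup>2 * (Y 1 \<omega>)\<^sup>2) \<le> 2 * (\<kappa>\<^sup>2 * signal_level p u) * \<rho>"
    using * L2_integrable[OF lin_power_L2[of 2 u]] L2_integrable[OF lin_square_mult_L2[of u \<beta>]] by auto
  then show "L2 (\<lambda>\<omega>. lin u \<omega> * Y 1 \<omega>)"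
    using lin_measurable response_measurable[OF first_observation] by (simp add: L2_def power_mult_distrib)
  show "expectation (\<lambda>\<omega>. (lin u \<omega> * Y 1 \<omega>)\<^sup>2) \<le> 2 * \<kappa>\<^sup>2 * \<rho> * signal_level p u"
    using le by (simp add: power_mult_distrib ac_simps)
qed

text \<open>
  The corresponding bound for the vector \<open>S\<close>, of order \<open>p\<^sup>2\<close> because of the factor \<open>g\<^sup>2\<close>. This is the
  estimate that needs eight moments: two linear forms and \<open>g\<close>, each squared.
\<close>

lemma lin_response_g:
  shows lin_response_g_L2: "L2 (\<lambda>\<omega>. lin u \<omega> * Y 1 \<omega> * g p X 1 \<omega>)"
    and lin_response_g_le: "expectation (\<lambda>\<omega>. (lin u \<omega> * Y 1 \<omega> * g p X 1 \<omega>)\<^sup>2)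
      \<le> 2 * \<kappa> ^ 4 * (real p)\<^sup>2 * \<rho> * signal_level p u"
proof -
  define a where "a = \<kappa> ^ 4 * (real p)\<^sup>2 * signal_level p u"
  have "(\<kappa> * signal_level p u) * (\<kappa> * real p)\<^sup>2 = \<kappa> ^ 3 * ((real p)\<^sup>2 * signal_level p u)"
    by (simp add: power_mult_distrib power3_eq_cube power2_eq_square)
  also have "\<dots> \<le> \<kappa> ^ 4 * ((real p)\<^sup>2 * signal_level p u)"
    using kappa_ge_1 signal_level_nonneg[of p u] by (intro mult_right_mono power_increasing) auto
  finally have E: "expectation (\<lambda>\<omega>. (lin u \<omega>)\<^sup>2 * (g p X 1 \<omega>)\<^sup>2) \<le> a"
    using lin_square_g_square_le[of u] by (simp add: a_def)
  have comm: "(\<lambda>\<omega>. (lin u \<omega>)\<^sup>2 * (g p X 1 \<omega>)\<^sup>2 * (lin \<beta> \<omega>)\<^sup>2) = (\<lambda>\<omega>. (lin u \<omega>)\<^sup>2 * (lin \<beta> \<omega>)\<^sup>2 * (g p X 1 \<omega>)\<^sup>2)"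
    by (simp add: ac_simps)
  have E': "expectation (\<lambda>\<omega>. (lin u \<omega>)\<^sup>2 * (g p X 1 \<omega>)\<^sup>2 * (lin \<beta> \<omega>)\<^sup>2) \<le> a * signal_level p \<beta>"
    using lin_square_mult_g_square_le[of u \<beta>] unfolding comm
    by (simp add: a_def power_mult_distrib power2_eq_square power4_eq_xxxx ac_simps)
  have meas: "(\<lambda>r. (\<Sum>j=1..p. u j * r j)\<^sup>2 * (pair_sum r)\<^sup>2) \<in> borel_measurable (vec_borel p)"
    by (intro borel_measurable_times borel_measurable_power linear_form_measurable pair_sum_measurable)
  have int: "integrable M (\<lambda>\<omega>. (lin u \<omega>)\<^sup>2 * (g p X 1 \<omega>)\<^sup>2 * (lin \<beta> \<omega>)\<^sup>2)"
    unfolding comm by (rule L2_mult_integrable[OF lin_square_mult_L2 g_square_L2])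
  note * = weighted_response_square[OF meas, unfolded linear_form_row pair_sum_row, OF _ _ int E E']
  have "integrable M (\<lambda>\<omega>. (lin u \<omega>)\<^sup>2 * (g p X 1 \<omega>)\<^sup>2 * (Y 1 \<omega>)\<^sup>2)"
    and le: "expectation (\<lambda>\<omega>. (lin u \<omega>)\<^sup>2 * (g p X 1 \<omega>)\<^sup>2 * (Y 1 \<omega>)\<^sup>2) \<le> 2 * a * \<rho>"
    using * L2_mult_integrable[OF lin_power_L2[of 2 u] g_square_L2] by auto
  moreover have eq: "(\<lambda>\<omega>. (lin u \<omega>)\<^sup>2 * (g p X 1 \<omega>)\<^sup>2 * (Y 1 \<omega>)\<^sup>2) = (\<lambda>\<omega>. (lin u \<omega> * Y 1 \<omega> * g p X 1 \<omega>)\<^sup>2)"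
    by (simp add: power_mult_distrib ac_simps)
  ultimately show "L2 (\<lambda>\<omega>. lin u \<omega> * Y 1 \<omega> * g p X 1 \<omega>)"
    using lin_measurable response_measurable[OF first_observation] g_measurable[OF first_observation]
    by (simp add: L2_def)
  show "expectation (\<lambda>\<omega>. (lin u \<omega> * Y 1 \<omega> * g p X 1 \<omega>)\<^sup>2)
      \<le> 2 * \<kappa> ^ 4 * (real p)\<^sup>2 * \<rho> * signal_level p u"
    using le unfolding eq by (simp add: a_def ac_simps)
qed

text \<open>
  The variables \<open>W\<close> and \<open>S\<close> as functions of an observation, which is the shape required by
  \<open>cross_U_statistic_variance\<close>.
\<close>

definition w_obs :: "nat \<Rightarrow> (nat \<Rightarrow> real) \<times> real \<Rightarrow> real" where
  "w_obs j z = fst z j * snd z"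

definition s_obs :: "nat \<Rightarrow> (nat \<Rightarrow> real) \<times> real \<Rightarrow> real" where
  "s_obs j z = w_obs j z * pair_sum (fst z)"

lemma w_obs: "j \<in> {1..p} \<Longrightarrow> w_obs j (obs i \<omega>) = W X Y i j \<omega>"
  and s_obs: "j \<in> {1..p} \<Longrightarrow> s_obs j (obs i \<omega>) = S p X Y i j \<omega>"
  by (simp_all add: w_obs_def s_obs_def obs_def W_def S_def pair_sum_row) (simp_all add: row_def)

lemma w_obs_measurable: "j \<in> {1..p} \<Longrightarrow> w_obs j \<in> borel_measurable (vec_borel p \<Otimes>\<^sub>M borel)"
  unfolding w_obs_def[abs_def]
  by (intro borel_measurable_times measurable_compose[OF measurable_fst component_measurable] measurable_snd)

lemma s_obs_measurable: "j \<in> {1..p} \<Longrightarrow> s_obs j \<in> borel_measurable (vec_borel p \<Otimes>\<^sub>M borel)"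
  unfolding s_obs_def[abs_def]
  by (intro borel_measurable_times w_obs_measurable measurable_compose[OF measurable_fst pair_sum_measurable])

lemma sum_w_obs: "(\<Sum>j=1..p. u j * w_obs j (obs 1 \<omega>)) = lin u \<omega> * Y 1 \<omega>"
  by (simp add: w_obs W_def lin_def sum_distrib_right mult.assoc)

lemma sum_s_obs: "(\<Sum>j=1..p. u j * s_obs j (obs 1 \<omega>)) = lin u \<omega> * Y 1 \<omega> * g p X 1 \<omega>"
  by (simp add: s_obs S_def W_def lin_def sum_distrib_right mult.assoc)

abbreviation unit_vec :: "nat \<Rightarrow> nat \<Rightarrow> real" where
  "unit_vec j \<equiv> \<lambda>i. if i = j then 1 else 0"

lemma unit_vec_level: "j \<in> {1..p} \<Longrightarrow> signal_level p (unit_vec j) = 1"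
  by (simp add: signal_level_def if_distrib[of "\<lambda>x. x\<^sup>2"] cong: if_cong)

lemma w_obs_L2: "j \<in> {1..p} \<Longrightarrow> L2 (\<lambda>\<omega>. w_obs j (obs 1 \<omega>))"
  using lin_response_L2[of "unit_vec j"] unfolding sum_w_obs[symmetric]
  by (simp add: if_distrib[of "\<lambda>x. x * _"] cong: if_cong)

lemma s_obs_L2: "j \<in> {1..p} \<Longrightarrow> L2 (\<lambda>\<omega>. s_obs j (obs 1 \<omega>))"
  using lin_response_g_L2[of "unit_vec j"] unfolding sum_s_obs[symmetric]
  by (simp add: if_distrib[of "\<lambda>x. x * _"] cong: if_cong)

lemma s_obs_square_le:
  "j \<in> {1..p} \<Longrightarrow> expectation (\<lambda>\<omega>. (s_obs j (obs 1 \<omega>))\<^sup>2) \<le> 2 * \<kappa> ^ 4 * (real p)\<^sup>2 * \<rho>"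
  using lin_response_g_le[of "unit_vec j"] unfolding sum_s_obs[symmetric]
  by (simp add: unit_vec_level if_distrib[of "\<lambda>x. x * _"] cong: if_cong)

lemma w_obs_mean:
  assumes j: "j \<in> {1..p}"
  shows "expectation (\<lambda>\<omega>. w_obs j (obs 1 \<omega>)) = \<beta> j"
proof -
  have noise: "expectation (\<lambda>\<omega>. X 1 j \<omega> * \<epsilon> 1 \<omega>) = 0"
    using noise_uncorrelated[OF sample_nonempty component_measurable[OF j]] entry_L2[OF j] j
    by (simp add: row_def)
  have int: "integrable M (\<lambda>\<omega>. X 1 j \<omega> * X 1 k \<omega>)" if "k \<in> {1..p}" for k
    using entry_L2[OF j] entry_L2[OF that] by (rule L2_mult_integrable)
  have "expectation (\<lambda>\<omega>. w_obs j (obs 1 \<omega>))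
      = expectation (\<lambda>\<omega>. (\<Sum>k=1..p. \<beta> k * (X 1 j \<omega> * X 1 k \<omega>)) + X 1 j \<omega> * \<epsilon> 1 \<omega>)"
    by (rule Bochner_Integration.integral_cong)
      (simp_all add: w_obs[OF j] W_def response_first lin_def distrib_left sum_distrib_left ac_simps)
  also have "\<dots> = (\<Sum>k=1..p. \<beta> k * expectation (\<lambda>\<omega>. X 1 j \<omega> * X 1 k \<omega>)) + 0"
    using int noise L2_mult_integrable[OF entry_L2[OF j] noise_L2[OF first_observation]]
    by (simp del: atLeastAtMost_iff)
  also have "\<dots> = (\<Sum>k=1..p. if k = j then \<beta> k else 0) + 0"
    using j by (intro arg_cong2[where f="(+)"] sum.cong refl) (simp add: entry_covariance)
  finally show ?thesis using j by simp
qed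

lemma s_obs_mean: "j \<in> {1..p} \<Longrightarrow> expectation (\<lambda>\<omega>. s_obs j (obs 1 \<omega>)) = \<theta> M p X Y j"
  by (simp add: s_obs \<theta>_def)

text \<open>
  Since \<open>\<theta>\<close> is the mean of \<open>S\<close>, the squared length of \<open>\<theta>\<close> is the mean of \<open>\<Sum>\<^sub>j \<theta>\<^sub>j S\<^sub>j\<close>. Its square
  is at most the second moment of that variable, which is at most the claimed bound times
  the squared length; one factor of the squared length cancels.
\<close>

lemma theta_square_le: "(\<Sum>j=1..p. (\<theta> M p X Y j)\<^sup>2) \<le> 2 * \<kappa> ^ 4 * (real p)\<^sup>2 * \<rho>"
proof -
  define t where "t = \<theta> M p X Y"
  define f where "f \<omega> = lin t \<omega> * Y 1 \<omega> * g p X 1 \<omega>" for \<omega>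
  define D where "D = 2 * \<kappa> ^ 4 * (real p)\<^sup>2 * \<rho>"
  have f: "L2 f" "expectation (\<lambda>\<omega>. (f \<omega>)\<^sup>2) \<le> D * signal_level p t"
    unfolding f_def D_def by (rule lin_response_g_L2, rule lin_response_g_le)
  have "expectation f = (\<Sum>j=1..p. t j * expectation (\<lambda>\<omega>. s_obs j (obs 1 \<omega>)))"
    unfolding f_def[abs_def] sum_s_obs[symmetric] using s_obs_L2
    by (simp add: L2_integrable del: atLeastAtMost_iff)
  also have "\<dots> = signal_level p t"
    by (simp add: s_obs_mean signal_level_def t_def power2_eq_square)
  finally have "(signal_level p t)\<^sup>2 \<le> D * signal_level p t"
    using Cauchy_Schwarz_expectation[OF f(1), of "\<lambda>_. 1"] f(2) by (simp add: prob_space)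
  moreover have "0 \<le> D" using rho_nonneg by (simp add: D_def)
  ultimately have "signal_level p t \<le> D"
    using signal_level_nonneg[of p t] by (cases "signal_level p t = 0") (auto simp: power2_eq_square)
  then show ?thesis by (simp add: D_def signal_level_def t_def)
qed

text \<open>
  The degenerate part contributes \<open>p\<^sup>3 / n\<^sup>2\<close>, since \<open>S\<close> has \<open>p\<close> coordinates, each with second
  moment of order \<open>p\<^sup>2\<close>; this is where the bound on \<open>p / n\<close> is needed to reach the order \<open>p\<^sup>2 / n\<close>.
\<close>

lemma cross_moment_estimation_error:
  assumes n: "2 \<le> n" and r: "real p \<le> r * real n"
  defines "err \<equiv> \<lambda>\<omega>. (\<Sum>i\<in>{1..n}. \<Sum>k\<in>{1..n} - {i}. \<Sum>j=1..p. W X Y i j \<omega> * S p X Y k j \<omega>)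
        / (real n * (real n - 1))
      - (\<Sum>j=1..p. \<beta> j * \<theta> M p X Y j)"
  shows "L2 err" and "expectation (\<lambda>\<omega>. (err \<omega>)\<^sup>2) \<le> (48 * r + 18) * \<kappa> ^ 6 * \<rho>\<^sup>2 * (real p)\<^sup>2 / real n"
proof -
  define D where "D = 2 * \<kappa> ^ 4 * (real p)\<^sup>2 * \<rho>"
  define K where "K = 2 * \<kappa>\<^sup>2 * \<rho>"
  have "0 \<le> K" "0 \<le> D" using rho_nonneg by (auto simp: K_def D_def)
  have K: "expectation (\<lambda>\<omega>. (\<Sum>j=1..p. u j * w_obs j (obs 1 \<omega>))\<^sup>2) \<le> K * (\<Sum>j=1..p. (u j)\<^sup>2)" for u
    unfolding sum_w_obs using lin_response_le[of u] by (simp add: K_def signal_level_def)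
  have "(\<Sum>j=1..p. expectation (\<lambda>\<omega>. (s_obs j (obs 1 \<omega>))\<^sup>2)) \<le> (\<Sum>j=1..p. D)"
    unfolding D_def by (intro sum_mono s_obs_square_le)
  then have B: "(\<Sum>j=1..p. expectation (\<lambda>\<omega>. (s_obs j (obs 1 \<omega>))\<^sup>2)) \<le> real p * D" by simp
  have "expectation (\<lambda>\<omega>. (\<Sum>j=1..p. \<beta> j * s_obs j (obs 1 \<omega>))\<^sup>2) \<le> D * signal_level p \<beta>"
    unfolding sum_s_obs D_def by (rule lin_response_g_le)
  also have "\<dots> \<le> D * \<rho>" using \<open>0 \<le> D\<close> signal_le_rho by (rule mult_left_mono[rotated])
  finally have V: "expectation (\<lambda>\<omega>. (\<Sum>j=1..p. \<beta> j * s_obs j (obs 1 \<omega>))\<^sup>2) \<le> D * \<rho>" .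
  have err: "err = (\<lambda>\<omega>. (\<Sum>i\<in>{1..n}. \<Sum>k\<in>{1..n} - {i}. \<Sum>j=1..p. w_obs j (obs i \<omega>) * s_obs j (obs k \<omega>))
        / (real n * (real n - 1))
      - (\<Sum>j=1..p. \<beta> j * \<theta> M p X Y j))"
    by (simp add: err_def w_obs s_obs)
  note var = cross_U_statistic_variance[OF n w_obs_measurable s_obs_measurable w_obs_L2 s_obs_L2
      w_obs_mean s_obs_mean K \<open>0 \<le> K\<close> B V]
  show "L2 err" unfolding err by (rule var(1))
  have pos: "real n - 1 > 0" "real n > 0" using n by auto
  have "real p / (real n - 1) \<le> 2 * r"
  proof -
    have "0 \<le> r" using r pos by (smt (verit) mult_neg_pos of_nat_0_le_iff)
    \<comment> \<open>For \<open>n \<ge> 2\<close>, replacing \<open>n - 1\<close> by \<open>n\<close> costs at most a factor of two.\<close>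
    have "real p \<le> r * real n" by (rule r)
    also have "\<dots> \<le> r * (2 * (real n - 1))" using n \<open>0 \<le> r\<close> by (intro mult_left_mono) auto
    finally show ?thesis using pos by (simp add: field_simps)
  qed
  have "expectation (\<lambda>\<omega>. (err \<omega>)\<^sup>2)
      \<le> 3 * (2 * K * (real p * D) / (real n * (real n - 1)) + D * \<rho> / real n
        + K * (\<Sum>j=1..p. (\<theta> M p X Y j)\<^sup>2) / real n)"
    unfolding err by (rule var(2))
  also have "\<dots> \<le> 3 * (2 * K * D / real n * (2 * r) + D * (\<kappa>\<^sup>2 * \<rho>) / real n + K * D / real n)"
  proof (intro mult_left_mono add_mono divide_right_mono)
    have "2 * K * (real p * D) / (real n * (real n - 1)) = 2 * K * D / real n * (real p / (real n - 1))"
      by simp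
    also have "\<dots> \<le> 2 * K * D / real n * (2 * r)"
      using \<open>real p / (real n - 1) \<le> 2 * r\<close> \<open>0 \<le> K\<close> \<open>0 \<le> D\<close> by (intro mult_left_mono) auto
    finally show "2 * K * (real p * D) / (real n * (real n - 1)) \<le> 2 * K * D / real n * (2 * r)" .
    show "\<rho> \<le> \<kappa>\<^sup>2 * \<rho>"
      using mult_right_mono[OF one_le_power[OF kappa_ge_1, of 2] rho_nonneg] by simp
    show "(\<Sum>j=1..p. (\<theta> M p X Y j)\<^sup>2) \<le> D" unfolding D_def by (rule theta_square_le)
  qed (use \<open>0 \<le> K\<close> \<open>0 \<le> D\<close> in auto)
  also have "\<dots> = 3 * (2 * K * D * (2 * r) + D * (\<kappa>\<^sup>2 * \<rho>) + K * D) / real n"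
    by (simp add: add_divide_distrib)
  also have "3 * (2 * K * D * (2 * r) + D * (\<kappa>\<^sup>2 * \<rho>) + K * D) = (48 * r + 18) * (\<kappa> ^ 4 * \<kappa>\<^sup>2) * \<rho>\<^sup>2 * (real p)\<^sup>2"
    by (simp add: K_def D_def power2_eq_square algebra_simps)
  also have "\<kappa> ^ 4 * \<kappa>\<^sup>2 = \<kappa> ^ 6" by (simp flip: power_add)
  finally show "expectation (\<lambda>\<omega>. (err \<omega>)\<^sup>2) \<le> (48 * r + 18) * \<kappa> ^ 6 * \<rho>\<^sup>2 * (real p)\<^sup>2 / real n" .
qed

section \<open>The variance of g and the estimated coefficient\<close>

lemma g_Suc: "g (Suc m) X 1 \<omega> = g m X 1 \<omega> + (\<Sum>j=1..m. X 1 j \<omega>) * X 1 (Suc m) \<omega>"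
  unfolding g_def by (rule pair_sum_Suc)

lemma expectation_mult_next_entry:
  assumes m: "Suc m \<le> p" and G: "G \<in> borel_measurable (vec_borel m)" and f: "f \<in> borel_measurable borel"
    and intG: "integrable M (\<lambda>\<omega>. G (\<lambda>j\<in>{1..m}. X 1 j \<omega>))"
    and intf: "integrable M (\<lambda>\<omega>. f (X 1 (Suc m) \<omega>) :: real)"
  shows "expectation (\<lambda>\<omega>. G (\<lambda>j\<in>{1..m}. X 1 j \<omega>) * f (X 1 (Suc m) \<omega>))
      = expectation (\<lambda>\<omega>. G (\<lambda>j\<in>{1..m}. X 1 j \<omega>)) * expectation (\<lambda>\<omega>. f (X 1 (Suc m) \<omega>))"
    and "integrable M (\<lambda>\<omega>. G (\<lambda>j\<in>{1..m}. X 1 j \<omega>) * f (X 1 (Suc m) \<omega>))"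
proof -
  have ind: "indep_var borel (\<lambda>\<omega>. G (\<lambda>j\<in>{1..m}. X 1 j \<omega>)) borel (\<lambda>\<omega>. f (X 1 (Suc m) \<omega>))"
    using m by (intro indep_var_of_restriction[OF entries_independent _ _ _ G f]) auto
  show "expectation (\<lambda>\<omega>. G (\<lambda>j\<in>{1..m}. X 1 j \<omega>) * f (X 1 (Suc m) \<omega>))
      = expectation (\<lambda>\<omega>. G (\<lambda>j\<in>{1..m}. X 1 j \<omega>)) * expectation (\<lambda>\<omega>. f (X 1 (Suc m) \<omega>))"
    by (rule indep_var_lebesgue_integral[OF ind intG intf])
  show "integrable M (\<lambda>\<omega>. G (\<lambda>j\<in>{1..m}. X 1 j \<omega>) * f (X 1 (Suc m) \<omega>))"
    by (rule indep_var_integrable[OF ind intG intf])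
qed

lemma partial_sum_L2: "m \<le> p \<Longrightarrow> L2 (\<lambda>\<omega>. \<Sum>j=1..m. X 1 j \<omega>)"
  by (intro L2_sum entry_L2) auto

lemma partial_sum_second_moment:
  assumes "m \<le> p"
  shows "expectation (\<lambda>\<omega>. (\<Sum>j=1..m. X 1 j \<omega>)\<^sup>2) = real m"
proof -
  have "expectation (\<lambda>\<omega>. (\<Sum>j=1..m. X 1 j \<omega>)\<^sup>2) = (\<Sum>j=1..m. \<Sum>k=1..m. expectation (\<lambda>\<omega>. X 1 j \<omega> * X 1 k \<omega>))"
    using assms by (intro expectation_square_sum entry_L2) auto
  also have "\<dots> = (\<Sum>j=1..m. \<Sum>k=1..m. if j = k then 1 else 0)"
    using assms by (intro sum.cong refl entry_covariance) auto
  finally show ?thesis by simp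
qed

text \<open>
  Adding a column adds the increment \<open>L V\<close> to \<open>g\<close>, where the new entry \<open>V\<close> is centered and
  independent of the previous entries, with \<open>L\<close> their sum. The increment is orthogonal to the old
  value of \<open>g\<close>, and its second moment is the number of previous entries, so the variances \<open>0 + 1 + \<dots> + (p - 1)\<close> add up.
\<close>

lemma partial_g_moments:
  assumes "m \<le> p"
  shows "L2 (g m X 1) \<and> expectation (g m X 1) = 0 \<and>
    expectation (\<lambda>\<omega>. (g m X 1 \<omega>)\<^sup>2) = real m * (real m - 1) / 2"
  using assms
proof (induction m)
  case 0
  then show ?case by (simp add: g_def[abs_def])
next
  case (Suc m)
  define L where "L \<omega> = (\<Sum>j=1..m. X 1 j \<omega>)" for \<omega>
  define V where "V = X 1 (Suc m)"
  have m: "m \<le> p" "Suc m \<in> {1..p}" using Suc.prems by auto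
  have IH: "L2 (g m X 1)" "expectation (g m X 1) = 0" "expectation (\<lambda>\<omega>. (g m X 1 \<omega>)\<^sup>2) = real m * (real m - 1) / 2"
    using Suc.IH m by auto
  have L: "L2 L" "expectation (\<lambda>\<omega>. (L \<omega>)\<^sup>2) = real m"
    unfolding L_def[abs_def] by (rule partial_sum_L2[OF m(1)], rule partial_sum_second_moment[OF m(1)])
  have V: "L2 V" "expectation V = 0" "expectation (\<lambda>\<omega>. (V \<omega>)\<^sup>2) = 1"
    unfolding V_def using entry_L2[OF m(2)] covariate_mean[OF first_observation m(2)]
      entry_covariance[OF m(2) m(2)] by (auto simp: power2_eq_square)
  define GL where "GL x = (\<Sum>j=1..m. x j :: real)" for x
  define Gg where "Gg x = (\<Sum>j=1..m. \<Sum>k=j+1..m. x j * x k :: real)" for x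
  have comp: "(\<lambda>x. x j) \<in> borel_measurable (vec_borel m)" if "j \<in> {1..m}" for j
    using that by (rule measurable_component_singleton)
  have meas: "GL \<in> borel_measurable (vec_borel m)" "Gg \<in> borel_measurable (vec_borel m)"
    unfolding GL_def[abs_def] Gg_def[abs_def] by (intro borel_measurable_sum borel_measurable_times comp; simp)+
  have eval: "GL (\<lambda>j\<in>{1..m}. X 1 j \<omega>) = L \<omega>" "Gg (\<lambda>j\<in>{1..m}. X 1 j \<omega>) = g m X 1 \<omega>" for \<omega>
    unfolding GL_def Gg_def L_def g_def by (intro sum.cong refl; simp)+
  note step = expectation_mult_next_entry[OF Suc.prems, folded V_def]
  have "expectation (\<lambda>\<omega>. g m X 1 \<omega> * L \<omega> * V \<omega>) = expectation (\<lambda>\<omega>. g m X 1 \<omega> * L \<omega>) * expectation V"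
    and int_gLV: "integrable M (\<lambda>\<omega>. g m X 1 \<omega> * L \<omega> * V \<omega>)"
    by (rule step[of "\<lambda>x. Gg x * GL x" "\<lambda>x. x", unfolded eval, OF borel_measurable_times[OF meas(2,1)]
          measurable_ident_sets[OF refl] L2_mult_integrable[OF IH(1) L(1)] L2_integrable[OF V(1)]])+
  then have gLV: "expectation (\<lambda>\<omega>. g m X 1 \<omega> * L \<omega> * V \<omega>) = 0" using V(2) by simp
  have "expectation (\<lambda>\<omega>. L \<omega> * V \<omega>) = expectation L * expectation V"
    and int_LV: "integrable M (\<lambda>\<omega>. L \<omega> * V \<omega>)"
    by (rule step[of GL "\<lambda>x. x", unfolded eval, OF meas(1)
          measurable_ident_sets[OF refl] L2_integrable[OF L(1)] L2_integrable[OF V(1)]])+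
  then have LV: "expectation (\<lambda>\<omega>. L \<omega> * V \<omega>) = 0" using V(2) by simp
  have "expectation (\<lambda>\<omega>. (L \<omega>)\<^sup>2 * (V \<omega>)\<^sup>2) = expectation (\<lambda>\<omega>. (L \<omega>)\<^sup>2) * expectation (\<lambda>\<omega>. (V \<omega>)\<^sup>2)"
    and int_L2V2: "integrable M (\<lambda>\<omega>. (L \<omega>)\<^sup>2 * (V \<omega>)\<^sup>2)"
    by (rule step[of "\<lambda>x. (GL x)\<^sup>2" "\<lambda>x. x\<^sup>2", unfolded eval, OF borel_measurable_power[OF meas(1)]
          borel_measurable_power[OF measurable_ident_sets[OF refl]] L2_square[OF L(1)] L2_square[OF V(1)]])+
  then have L2V2: "expectation (\<lambda>\<omega>. (L \<omega>)\<^sup>2 * (V \<omega>)\<^sup>2) = real m" using V(3) L(2) by simp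
  have g: "g (Suc m) X 1 \<omega> = g m X 1 \<omega> + L \<omega> * V \<omega>" for \<omega>
    unfolding g_Suc L_def V_def ..
  have "L2 (\<lambda>\<omega>. L \<omega> * V \<omega>)"
    using int_L2V2 int_LV by (simp add: L2_def power_mult_distrib borel_measurable_integrable)
  then have 1: "L2 (g (Suc m) X 1)"
    using L2_add[OF IH(1)] by (simp add: g[abs_def])
  have 2: "expectation (g (Suc m) X 1) = 0"
    using IH LV int_LV by (simp add: g[abs_def] L2_integrable)
  have "(\<lambda>\<omega>. (g (Suc m) X 1 \<omega>)\<^sup>2)
      = (\<lambda>\<omega>. (g m X 1 \<omega>)\<^sup>2 + 2 * (g m X 1 \<omega> * L \<omega> * V \<omega>) + (L \<omega>)\<^sup>2 * (V \<omega>)\<^sup>2)"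
    by (simp add: g power2_sum power_mult_distrib ac_simps)
  then have "expectation (\<lambda>\<omega>. (g (Suc m) X 1 \<omega>)\<^sup>2) = real m * (real m - 1) / 2 + real m"
    using L2_square[OF IH(1)] gLV L2V2 int_gLV int_L2V2 IH(3) by simp
  also have "\<dots> = real (Suc m) * (real (Suc m) - 1) / 2" by (simp add: field_simps)
  finally show ?case using 1 2 by blast
qed

lemma g_mean_zero: "expectation (g p X 1) = 0"
  and g_second_moment: "expectation (\<lambda>\<omega>. (g p X 1 \<omega>)\<^sup>2) = real p * (real p - 1) / 2"
  and var_g_eq: "var_g M p X = real p * (real p - 1) / 2"
  using partial_g_moments[of p] by (auto simp: var_g_def)

lemma sum_g_second_moment:
  shows "L2 (\<lambda>\<omega>. \<Sum>i=1..n. g p X i \<omega>)"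
    and "expectation (\<lambda>\<omega>. (\<Sum>i=1..n. g p X i \<omega>)\<^sup>2) = real n * var_g M p X"
proof -
  define f where "f = (\<lambda>z :: (nat \<Rightarrow> real) \<times> real. pair_sum (fst z))"
  have f: "f \<in> borel_measurable (vec_borel p \<Otimes>\<^sub>M borel)"
    unfolding f_def by (rule measurable_compose[OF measurable_fst pair_sum_measurable])
  have eval: "f (obs i \<omega>) = g p X i \<omega>" for i \<omega>
    by (simp add: f_def obs_def pair_sum_row)
  have L: "L2 (\<lambda>\<omega>. f (obs 1 \<omega>))" unfolding eval by (rule g_L2)
  have 0: "expectation (\<lambda>\<omega>. f (obs 1 \<omega>)) = 0" unfolding eval by (rule g_mean_zero)
  show "L2 (\<lambda>\<omega>. \<Sum>i=1..n. g p X i \<omega>)"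
    using L2_Z[OF _ f L] unfolding eval by (rule L2_sum)
  show "expectation (\<lambda>\<omega>. (\<Sum>i=1..n. g p X i \<omega>)\<^sup>2) = real n * var_g M p X"
    using expectation_square_centered_sum[OF f L 0] unfolding eval by (simp add: g_second_moment var_g_eq)
qed

definition scaled_difference :: "'a \<Rightarrow> real" where
  "scaled_difference \<omega> = sqrt (real n) *
     (T n p X Y (c_star M p X Y \<beta>) \<omega> - T n p X Y (c_hat M n p X Y \<omega>) \<omega>)"

text \<open>
  The Cauchy--Schwarz inequality for the estimation error of the coefficient times the sum of the
  \<open>g\<^sub>i\<close>. For \<open>p \<ge> 2\<close> the variance of \<open>g\<close> is at least \<open>(p / 2)\<^sup>2\<close>, which cancels the factor \<open>p\<^sup>2\<close> in the
  error. For \<open>p \<le> 1\<close> that variance is zero and the division by zero makes both coefficients zero.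
\<close>

lemma scaled_difference_L1_bound:
  assumes n: "2 \<le> n" and r: "real p \<le> r * real n" and "0 \<le> r"
  shows "integrable M scaled_difference"
    and "expectation (\<lambda>\<omega>. \<bar>scaled_difference \<omega>\<bar>) \<le> 4 * sqrt ((48 * r + 18) * \<kappa> ^ 6 * \<rho>\<^sup>2 / real n)"
proof -
  define Q where "Q = (48 * r + 18) * \<kappa> ^ 6 * \<rho>\<^sup>2"
  have "0 \<le> Q" using \<open>0 \<le> r\<close> kappa_ge_1 by (simp add: Q_def)
  define err where "err \<omega> = (\<Sum>i\<in>{1..n}. \<Sum>k\<in>{1..n} - {i}. \<Sum>j=1..p. W X Y i j \<omega> * S p X Y k j \<omega>)
        / (real n * (real n - 1))
      - (\<Sum>j=1..p. \<beta> j * \<theta> M p X Y j)" for \<omega>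
  define sg where "sg \<omega> = (\<Sum>i=1..n. g p X i \<omega>)" for \<omega>
  define V where "V = var_g M p X"
  have errL: "L2 err" and err2: "expectation (\<lambda>\<omega>. (err \<omega>)\<^sup>2) \<le> Q * (real p)\<^sup>2 / real n"
    using cross_moment_estimation_error[OF n r] unfolding err_def[abs_def] Q_def by auto
  have sgL: "L2 sg" and sg2: "expectation (\<lambda>\<omega>. (sg \<omega>)\<^sup>2) = real n * V"
    using sum_g_second_moment unfolding sg_def[abs_def] V_def by auto
  have npos: "real n > 0" using n by simp
  have diff: "scaled_difference \<omega> = 2 / (V * sqrt (real n)) * (err \<omega> * sg \<omega>)" for \<omega>
  proof -
    have frac: "s * (2 / V * a * (b / (s * s))) = 2 / (V * s) * (a * b)" if "s > 0" for s a b :: real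
      using that by simp
    have "scaled_difference \<omega> = sqrt (real n) * ((c_hat M n p X Y \<omega> - c_star M p X Y \<beta>) * g_mean n p X \<omega>)"
      by (simp add: scaled_difference_def T_def algebra_simps)
    also have "c_hat M n p X Y \<omega> - c_star M p X Y \<beta> = 2 / V * err \<omega>"
      by (simp add: c_hat_def c_star_def V_def err_def diff_divide_distrib algebra_simps)
    also have "g_mean n p X \<omega> = sg \<omega> / (sqrt (real n) * sqrt (real n))"
      by (simp add: g_mean_def sg_def)
    also have "sqrt (real n) * (2 / V * err \<omega> * (sg \<omega> / (sqrt (real n) * sqrt (real n))))
        = 2 / (V * sqrt (real n)) * (err \<omega> * sg \<omega>)"
      by (rule frac) (use npos in simp)
    finally show ?thesis .
  qed
  have int: "integrable M (\<lambda>\<omega>. err \<omega> * sg \<omega>)" by (rule L2_mult_integrable[OF errL sgL])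
  show "integrable M scaled_difference"
    unfolding diff[abs_def] by (rule integrable_mult_right[OF int])
  show "expectation (\<lambda>\<omega>. \<bar>scaled_difference \<omega>\<bar>) \<le> 4 * sqrt ((48 * r + 18) * \<kappa> ^ 6 * \<rho>\<^sup>2 / real n)"
  proof (cases "p \<le> 1")
    case True
    then have "p = 0 \<or> p = 1" by linarith
    moreover have "V = real p * (real p - 1) / 2" by (simp add: V_def var_g_eq)
    ultimately have "V = 0" by auto
    then show ?thesis using \<open>0 \<le> Q\<close> npos by (simp add: diff Q_def)
  next
    case False
    then have "2 \<le> real p" by simp
    then have "(real p / 2)\<^sup>2 \<le> V"
      using mult_left_mono[of 2 "real p" "real p"] by (simp add: V_def var_g_eq power2_eq_square field_simps)
    then have sqrtV: "real p / 2 \<le> sqrt V" by (rule real_le_rsqrt)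
    then have "0 < sqrt V" using \<open>2 \<le> real p\<close> by linarith
    then have "0 < V" by simp
    have absL: "L2 (\<lambda>\<omega>. \<bar>err \<omega>\<bar>)" "L2 (\<lambda>\<omega>. \<bar>sg \<omega>\<bar>)"
      using errL sgL by (auto simp: L2_def)
    have CS: "expectation (\<lambda>\<omega>. \<bar>err \<omega>\<bar> * \<bar>sg \<omega>\<bar>) \<le> (real p * sqrt (Q / real n)) * sqrt (real n * V)"
      using \<open>0 \<le> Q\<close> npos \<open>0 < V\<close> err2 sg2
      by (intro Cauchy_Schwarz_bound absL) (simp_all add: power_mult_distrib mult.commute)
    have "expectation (\<lambda>\<omega>. \<bar>scaled_difference \<omega>\<bar>) = 2 / (V * sqrt (real n)) * expectation (\<lambda>\<omega>. \<bar>err \<omega>\<bar> * \<bar>sg \<omega>\<bar>)"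
      using \<open>0 < V\<close> npos by (simp add: diff abs_mult)
    also have "\<dots> \<le> 2 / (V * sqrt (real n)) * ((real p * sqrt (Q / real n)) * sqrt (real n * V))"
      using \<open>0 < V\<close> npos CS by (intro mult_left_mono) auto
    also have "\<dots> = 2 * real p * sqrt (Q / real n) * (sqrt V / V)"
      using npos by (simp add: real_sqrt_mult)
    also have "sqrt V / V = 1 / sqrt V" using \<open>0 < V\<close> by (simp add: real_div_sqrt field_simps)
    also have "2 * real p * sqrt (Q / real n) * (1 / sqrt V) = (real p / sqrt V) * (2 * sqrt (Q / real n))"
      by simp
    also have "\<dots> \<le> 2 * (2 * sqrt (Q / real n))"
      using sqrtV \<open>0 < sqrt V\<close> \<open>0 \<le> Q\<close> npos by (intro mult_right_mono) (auto simp: field_simps)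
    finally show ?thesis by (simp add: Q_def)
  qed
qed

lemma scaled_difference_tail_bound:
  assumes "2 \<le> n" "real p \<le> r * real n" "0 \<le> r" and "0 < e"
  shows "prob {\<omega> \<in> space M. \<bar>scaled_difference \<omega>\<bar> > e} \<le> 4 * sqrt ((48 * r + 18) * \<kappa> ^ 6 * \<rho>\<^sup>2 / real n) / e"
proof -
  note L1 = scaled_difference_L1_bound[OF assms(1-3)]
  have "prob {\<omega> \<in> space M. \<bar>scaled_difference \<omega>\<bar> > e} \<le> prob {\<omega> \<in> space M. \<bar>scaled_difference \<omega>\<bar> \<ge> e}"
    using borel_measurable_integrable[OF L1(1)] by (intro finite_measure_mono) auto
  also have "\<dots> \<le> expectation (\<lambda>\<omega>. \<bar>scaled_difference \<omega>\<bar>) / e"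
    using L1(1) \<open>0 < e\<close> by (intro integral_Markov_inequality_measure[where A="{}"]) auto
  also have "\<dots> \<le> 4 * sqrt ((48 * r + 18) * \<kappa> ^ 6 * \<rho>\<^sup>2 / real n) / e"
    using L1(2) \<open>0 < e\<close> by (simp add: divide_right_mono)
  finally show ?thesis .
qed

end
end

theorem proposition2p4:
  fixes M :: "nat \<Rightarrow> 'a measure"
    and p :: "nat \<Rightarrow> nat"
    and X :: "nat \<Rightarrow> nat \<Rightarrow> nat \<Rightarrow> 'a \<Rightarrow> real"
    and Y \<epsilon> :: "nat \<Rightarrow> nat \<Rightarrow> 'a \<Rightarrow> real"
    and \<beta> :: "nat \<Rightarrow> nat \<Rightarrow> real"
    and \<sigma> :: "nat \<Rightarrow> real"
  assumes model:
      "\<And>n. n \<ge> 1 \<Longrightarrow> linear_model (M n) n (p n) (X n) (Y n) (\<epsilon> n) (\<beta> n) (\<sigma> n)"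
    and signal_noise_bounded:
      "(\<lambda>n. signal_level (p n) (\<beta> n) + (\<sigma> n)\<^sup>2) \<in> O(\<lambda>_. 1)"
    and dimension_ratio_bounded:
      "(\<lambda>n. real (p n) / real n) \<in> O(\<lambda>_. 1)"
    and eighth_moments_bounded:
      "\<exists>C. \<forall>n\<ge>1. \<forall>j\<in>{1..p n}. integrable (M n) (\<lambda>\<omega>. (X n 1 j \<omega>) ^ 8) \<and>
             prob_space.expectation (M n) (\<lambda>\<omega>. (X n 1 j \<omega>) ^ 8) \<le> C"
    and columns_independent:
      "\<And>n. n \<ge> 1 \<Longrightarrow> independent_columns (M n) n (p n) (X n)"
  shows "converges_in_probability M
           (\<lambda>n \<omega>. sqrt (real n) *
              (T n (p n) (X n) (Y n) (c_star (M n) (p n) (X n) (Y n) (\<beta> n)) \<omega>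
               - T n (p n) (X n) (Y n) (c_hat (M n) n (p n) (X n) (Y n) \<omega>) \<omega>))
           0"
proof -
  obtain C\<^sub>0 where C\<^sub>0: "\<And>n j. n \<ge> 1 \<Longrightarrow> j \<in> {1..p n} \<Longrightarrow> integrable (M n) (\<lambda>\<omega>. (X n 1 j \<omega>) ^ 8)"
    "\<And>n j. n \<ge> 1 \<Longrightarrow> j \<in> {1..p n} \<Longrightarrow> prob_space.expectation (M n) (\<lambda>\<omega>. (X n 1 j \<omega>) ^ 8) \<le> C\<^sub>0"
    using eighth_moments_bounded by blast
  \<comment> \<open>When no \<open>p n\<close> is positive, the given bound may be negative.\<close>
  define C where "C = max C\<^sub>0 0"
  have model_n: "independent_columns_model (M n) n (p n) (X n) (Y n) (\<epsilon> n) (\<beta> n) (\<sigma> n) C" if "n \<ge> 1" for n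
    unfolding independent_columns_model_def independent_columns_model_axioms_def
    using model[OF that] C\<^sub>0[OF that] columns_independent[OF that] that
    by (auto simp: C_def le_max_iff_disj)
  obtain R where R: "R > 0" "\<forall>\<^sub>F n in sequentially. norm (signal_level (p n) (\<beta> n) + (\<sigma> n)\<^sup>2) \<le> R * norm (1::real)"
    using landau_o.bigE[OF signal_noise_bounded] by blast
  obtain r where r: "r > 0" "\<forall>\<^sub>F n in sequentially. norm (real (p n) / real n) \<le> r * norm (1::real)"
    using landau_o.bigE[OF dimension_ratio_bounded] by blast
  define k where "k = 247 * (1 + C)"
  define Q where "Q = (48 * r + 18) * k ^ 6 * R\<^sup>2"
  define Z where "Z n \<omega> = sqrt (real n) *
              (T n (p n) (X n) (Y n) (c_star (M n) (p n) (X n) (Y n) (\<beta> n)) \<omega>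
               - T n (p n) (X n) (Y n) (c_hat (M n) n (p n) (X n) (Y n) \<omega>) \<omega>)" for n \<omega>
  have bounds: "\<forall>\<^sub>F n in sequentially. 2 \<le> n \<and> signal_level (p n) (\<beta> n) + (\<sigma> n)\<^sup>2 \<le> R \<and> real (p n) \<le> r * real n"
    using eventually_ge_at_top[of 2] R(2) r(2)
    by eventually_elim (auto simp: field_simps)
  have eventual: "\<forall>\<^sub>F n in sequentially. Z n \<in> borel_measurable (M n) \<and>
      (\<forall>e>0. measure (M n) {\<omega> \<in> space (M n). \<bar>Z n \<omega> - 0\<bar> > e} \<le> 4 * sqrt (Q / real n) / e)"
    using bounds
  proof eventually_elim
    case (elim n)
    interpret independent_columns_model "M n" n "p n" "X n" "Y n" "\<epsilon> n" "\<beta> n" "\<sigma> n" C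
      using model_n elim by simp
    have Z: "Z n = scaled_difference" by (simp add: Z_def scaled_difference_def fun_eq_iff)
    have "\<rho> \<le> R" using elim by (simp add: \<rho>_def)
    then have "(48 * r + 18) * \<kappa> ^ 6 * \<rho>\<^sup>2 \<le> Q"
      unfolding Q_def k_def \<kappa>_def using r(1) rho_nonneg by (intro mult_left_mono power_mono) auto
    then have le: "4 * sqrt ((48 * r + 18) * \<kappa> ^ 6 * \<rho>\<^sup>2 / real n) / e \<le> 4 * sqrt (Q / real n) / e" if "e > 0" for e
      using that by (intro divide_right_mono mult_left_mono real_sqrt_le_mono) auto
    show ?case
      using scaled_difference_L1_bound(1)[of r] scaled_difference_tail_bound[of r] le elim r(1)
      unfolding Z by (auto intro: order_trans borel_measurable_integrable)
  qed
  have lim: "(\<lambda>n. 4 * sqrt (Q / real n) / e) \<longlonglongrightarrow> 0" for e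
  proof -
    have "(\<lambda>n. 4 * sqrt (Q / real n) * (1 / e)) \<longlonglongrightarrow> 4 * sqrt 0 * (1 / e)"
      by (intro tendsto_intros lim_const_over_n)
    then show ?thesis by simp
  qed
  show ?thesis
    unfolding converges_in_probability_def Z_def[symmetric]
  proof (intro conjI allI impI)
    show "\<forall>\<^sub>F n in sequentially. (\<lambda>\<omega>. Z n \<omega>) \<in> borel_measurable (M n)"
      using eventual by eventually_elim simp
    fix e :: real assume "e > 0"
    show "(\<lambda>n. measure (M n) {\<omega> \<in> space (M n). e < \<bar>Z n \<omega> - 0\<bar>}) \<longlonglongrightarrow> 0"
    proof (rule tendsto_sandwich[OF _ _ tendsto_const lim])
      show "\<forall>\<^sub>F n in sequentially. measure (M n) {\<omega> \<in> space (M n). e < \<bar>Z n \<omega> - 0\<bar>} \<le> 4 * sqrt (Q / real n) / e"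
        using eventual \<open>e > 0\<close> by (auto elim: eventually_mono)
    qed simp
  qed
qed

end
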